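(* Let $X=D_{46}+D_{47}$ and $Y=SXS^{-1}=-(D_{26}+D_{27})$. Then $\operatorname{Lie}\{X,Y\}=\mathfrak g_2$. With $V_0=\operatorname{span}\{X,Y\}$ and $V_{r+1}=V_r+[V_r,V_r]$, the dimensions of $V_0,V_1,V_2,V_3,V_4,V_5$ are respectively $2,3,5,11,14,14$. Consequently every element of the group $G_2$ is a finite product of elements of the form $e^{tX}$ ($t\in\mathbb R$), $S$, and their inverses.
   Context: Octonions: $\mathbb O$ has real basis $1,e_1,\dots,e_7$ with $1$ the identity, $e_i^2=-1$, and multiplication given by the oriented triples $(123),(145),(176),(246),(257),(347),(365)$: for a triple $(abc)$, $e_ae_b=e_c$, $e_be_c=e_a$, $e_ce_a=e_b$, and reversing the order changes the sign. $V=\operatorname{Im}\mathbb O=\operatorname{span}\{e_1,\dots,e_7\}$. $G_2=\operatorname{Aut}(\mathbb O)$ and $\mathfrak g_2=\operatorname{Der}(\mathbb O)$ are identified with their faithful actions on $V$. $D_{ij}=D_{e_i,e_j}\in\mathfrak g_2$, where $D_{a,b}(x)=[[a,b],x]-3[a,b,x]$, with $[a,b]=ab-ba$ and associator $[a,b,x]=(ab)x-a(bx)$. The switch $S\in G_2$ is the involution with $S(e_1)=e_1$, $S(e_2)=e_4$, $S(e_3)=e_5$, $S(e_4)=e_2$, $S(e_5)=e_3$, $S(e_6)=-e_6$, $S(e_7)=-e_7$. $\operatorname{Lie}\{X,Y\}$ is the smallest real Lie subalgebra containing $X,Y$, and $[V_r,V_r]$ is the span of commutators of elements of $V_r$. 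*)

theory Defs
  imports "HOL-Analysis.Analysis"
begin

text \<open>
  Octonions are vectors in \<open>real ^ 8\<close>. The numerals \<open>0, 1, ..., 7\<close> are the eight distinct elements
  of the index type \<open>8\<close>; the basis vector with index \<open>0\<close> is the identity, the others
  are the imaginary units. The library's \<open>times\<close> on vectors is componentwise and is never used.
  Endomorphisms of the octonions are \<open>8 \<times> 8\<close> matrices acting by \<open>*v\<close>.
\<close>

type_synonym octonion = "real ^ 8"
type_synonym oct_end = "real ^ 8 ^ 8"

definition oct_e :: "8 \<Rightarrow> octonion"
  where "oct_e i = axis i 1"

definition oct_triples :: "(8 \<times> 8 \<times> 8) set"
  where "oct_triples = {(1,2,3), (1,4,5), (1,7,6), (2,4,6), (2,5,7), (3,4,7), (3,6,5)}"

definition oct_cyclic :: "(8 \<times> 8 \<times> 8) set"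
  where "oct_cyclic = (\<Union>(a, b, c) \<in> oct_triples. {(a, b, c), (b, c, a), (c, a, b)})"

text \<open>
  For distinct \<open>i, j \<noteq> 0\<close> exactly one term of the sum below is nonzero: any two distinct imaginary
  units lie in exactly one of the seven triples.
\<close>

definition oct_basis_mult :: "8 \<Rightarrow> 8 \<Rightarrow> octonion"
  where "oct_basis_mult i j =
    (if i = 0 then oct_e j
     else if j = 0 then oct_e i
     else if i = j then - oct_e 0
     else (\<Sum>k\<in>UNIV. (of_bool ((i, j, k) \<in> oct_cyclic) - of_bool ((j, i, k) \<in> oct_cyclic)) *\<^sub>R oct_e k))"

definition oct_mult :: "octonion \<Rightarrow> octonion \<Rightarrow> octonion"  (infixl "\<odot>" 70)
  where "x \<odot> y = (\<Sum>i\<in>UNIV. \<Sum>j\<in>UNIV. (x $ i * y $ j) *\<^sub>R oct_basis_mult i j)"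

definition Im_oct :: "octonion set"
  where "Im_oct = span (oct_e ` {1, 2, 3, 4, 5, 6, 7})"

definition oct_comm :: "octonion \<Rightarrow> octonion \<Rightarrow> octonion"
  where "oct_comm a b = a \<odot> b - b \<odot> a"

definition oct_assoc :: "octonion \<Rightarrow> octonion \<Rightarrow> octonion \<Rightarrow> octonion"
  where "oct_assoc a b x = (a \<odot> b) \<odot> x - a \<odot> (b \<odot> x)"

text \<open>
  Automorphisms and derivations are taken on the whole algebra. Restriction to \<open>Im_oct\<close> is well
  defined and injective on both, which is shown at the end of this theory, so this is
  the same as working with the faithful actions on \<open>Im_oct\<close>.
\<close>

definition G2 :: "oct_end set"
  where "G2 = {A. invertible A \<and> (\<forall>x y. A *v (x \<odot> y) = (A *v x) \<odot> (A *v y))}"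

definition g2 :: "oct_end set"
  where "g2 = {A. \<forall>x y. A *v (x \<odot> y) = (A *v x) \<odot> y + x \<odot> (A *v y)}"

definition oct_D :: "octonion \<Rightarrow> octonion \<Rightarrow> oct_end"
  where "oct_D a b = matrix (\<lambda>x. oct_comm (oct_comm a b) x - 3 *\<^sub>R oct_assoc a b x)"

abbreviation De :: "8 \<Rightarrow> 8 \<Rightarrow> oct_end"
  where "De i j \<equiv> oct_D (oct_e i) (oct_e j)"

definition switch :: oct_end
  where "switch = matrix (\<lambda>x. x $ 0 *\<^sub>R oct_e 0 + x $ 1 *\<^sub>R oct_e 1
    + x $ 2 *\<^sub>R oct_e 4 + x $ 3 *\<^sub>R oct_e 5 + x $ 4 *\<^sub>R oct_e 2 + x $ 5 *\<^sub>R oct_e 3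
    - x $ 6 *\<^sub>R oct_e 6 - x $ 7 *\<^sub>R oct_e 7)"

definition bracket :: "oct_end \<Rightarrow> oct_end \<Rightarrow> oct_end"
  where "bracket A B = A ** B - B ** A"

definition lie_subalgebra :: "oct_end set \<Rightarrow> bool"
  where "lie_subalgebra L \<longleftrightarrow> subspace L \<and> (\<forall>A\<in>L. \<forall>B\<in>L. bracket A B \<in> L)"

definition Lie :: "oct_end set \<Rightarrow> oct_end set"
  where "Lie T = lie_subalgebra hull T"

primrec lie_filt :: "oct_end \<Rightarrow> oct_end \<Rightarrow> nat \<Rightarrow> oct_end set"
  where
    "lie_filt X Y 0 = span {X, Y}"
  | "lie_filt X Y (Suc r) =
      {A + B | A B. A \<in> lie_filt X Y r \<and>
         B \<in> span {bracket P Q | P Q. P \<in> lie_filt X Y r \<and> Q \<in> lie_filt X Y r}}"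

text \<open>
  The exponential series is written out because \<open>exp\<close> and \<open>^\<close> need a normed algebra, which
  matrices with \<open>**\<close> are not in the library.
\<close>

definition mat_exp :: "oct_end \<Rightarrow> oct_end"
  where "mat_exp A = (\<Sum>n. (((**) A ^^ n) (mat 1)) /\<^sub>R fact n)"

definition mat_prod :: "oct_end list \<Rightarrow> oct_end"
  where "mat_prod ws = foldr (**) ws (mat 1)"

subsection \<open>Sanity checks\<close>

lemma UNIV_8: "(UNIV :: 8 set) = {0, 1, 2, 3, 4, 5, 6, 7}"
proof -
  have "card {0, 1, 2, 3, 4, 5, 6, 7 :: 8} = CARD(8)"
    by simp
  then show ?thesis
    by (metis card_subset_eq finite subset_UNIV)
qed

lemma bilinear_oct_mult: "bilinear (\<odot>)"
  unfolding bilinear_def oct_mult_def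
  by (auto intro!: linearI simp: scaleR_sum_right algebra_simps sum.distrib)

lemma oct_D_apply: "oct_D a b *v x = oct_comm (oct_comm a b) x - 3 *\<^sub>R oct_assoc a b x"
proof -
  note [simp] = bilinear_ladd[OF bilinear_oct_mult] bilinear_radd[OF bilinear_oct_mult]
    bilinear_lmul[OF bilinear_oct_mult] bilinear_rmul[OF bilinear_oct_mult]
  have "linear (\<lambda>x. oct_comm (oct_comm a b) x - 3 *\<^sub>R oct_assoc a b x)"
    by (rule linearI) (simp_all add: oct_comm_def oct_assoc_def algebra_simps)
  then show ?thesis
    by (simp add: oct_D_def matrix_works)
qed

lemma switch_apply:
  "switch *v oct_e 0 = oct_e 0"  "switch *v oct_e 1 = oct_e 1"
  "switch *v oct_e 2 = oct_e 4"  "switch *v oct_e 3 = oct_e 5"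
  "switch *v oct_e 4 = oct_e 2"  "switch *v oct_e 5 = oct_e 3"
  "switch *v oct_e 6 = - oct_e 6"  "switch *v oct_e 7 = - oct_e 7"
proof -
  let ?f = "\<lambda>x :: octonion. x $ 0 *\<^sub>R oct_e 0 + x $ 1 *\<^sub>R oct_e 1
    + x $ 2 *\<^sub>R oct_e 4 + x $ 3 *\<^sub>R oct_e 5 + x $ 4 *\<^sub>R oct_e 2 + x $ 5 *\<^sub>R oct_e 3
    - x $ 6 *\<^sub>R oct_e 6 - x $ 7 *\<^sub>R oct_e 7"
  have "linear ?f"
    by (rule linearI) (simp_all add: algebra_simps)
  then have "switch *v x = ?f x" for x
    by (simp add: switch_def matrix_works)
  then show
    "switch *v oct_e 0 = oct_e 0"  "switch *v oct_e 1 = oct_e 1"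
    "switch *v oct_e 2 = oct_e 4"  "switch *v oct_e 3 = oct_e 5"
    "switch *v oct_e 4 = oct_e 2"  "switch *v oct_e 5 = oct_e 3"
    "switch *v oct_e 6 = - oct_e 6"  "switch *v oct_e 7 = - oct_e 7"
    by (simp_all add: oct_e_def axis_def)
qed

lemma Im_oct_iff: "x \<in> Im_oct \<longleftrightarrow> x $ 0 = 0"
proof
  assume "x \<in> Im_oct"
  then show "x $ 0 = 0"
    unfolding Im_oct_def
    by (induction rule: span_induct_alt) (auto simp: oct_e_def axis_def)
next
  assume x: "x $ 0 = 0"
  have "x = (\<Sum>i\<in>UNIV. x $ i *\<^sub>R oct_e i)"
    by (simp add: vec_eq_iff oct_e_def axis_def if_distrib cong: if_cong)
  also have "\<dots> = (\<Sum>i\<in>{1, 2, 3, 4, 5, 6, 7}. x $ i *\<^sub>R oct_e i)"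
  proof (rule sum.mono_neutral_right)
    show "\<forall>i \<in> UNIV - {1, 2, 3, 4, 5, 6, 7}. x $ i *\<^sub>R oct_e i = 0"
    proof
      fix i :: 8
      assume "i \<in> UNIV - {1, 2, 3, 4, 5, 6, 7}"
      then have "i = 0"
        using UNIV_8 by blast
      then show "x $ i *\<^sub>R oct_e i = 0"
        using x by simp
    qed
  qed simp_all
  also have "\<dots> \<in> Im_oct"
    unfolding Im_oct_def by (intro span_sum span_scale span_base) auto
  finally show "x \<in> Im_oct" .
qed

lemma oct_mult_one: "oct_e 0 \<odot> x = x" "x \<odot> oct_e 0 = x"
proof -
  have e: "(\<Sum>i\<in>UNIV. x $ i *\<^sub>R oct_e i) = x"
    by (simp add: vec_eq_iff oct_e_def axis_def if_distrib cong: if_cong)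
  have "oct_e 0 \<odot> x = (\<Sum>i\<in>(UNIV :: 8 set). if i = 0 then \<Sum>j\<in>UNIV. x $ j *\<^sub>R oct_e j else 0)"
    unfolding oct_mult_def
    by (intro sum.cong refl) (auto simp: oct_e_def axis_def oct_basis_mult_def intro!: sum.cong)
  then show "oct_e 0 \<odot> x = x"
    using e by simp
  have "x \<odot> oct_e 0 = (\<Sum>i\<in>(UNIV :: 8 set). \<Sum>j\<in>(UNIV :: 8 set). if j = 0 then x $ i *\<^sub>R oct_e i else 0)"
    unfolding oct_mult_def
    by (intro sum.cong refl) (auto simp: oct_e_def axis_def oct_basis_mult_def)
  then show "x \<odot> oct_e 0 = x"
    using e by simp
qed

lemma oct_basis_mult_sym:
  "oct_basis_mult i j + oct_basis_mult j i =
    (if j = 0 then 2 *\<^sub>R oct_e i else 0) + (if i = 0 then 2 *\<^sub>R oct_e j else 0)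
    - (if i = j then 2 *\<^sub>R oct_e 0 else 0)"
  by (simp add: oct_basis_mult_def scaleR_2 scaleR_left_diff_distrib sum_subtractf)

lemma oct_mult_sym:
  "x \<odot> y + y \<odot> x = (2 * y $ 0) *\<^sub>R x + (2 * x $ 0) *\<^sub>R y - (2 * (x \<bullet> y)) *\<^sub>R oct_e 0"
proof -
  have e: "(\<Sum>i\<in>UNIV. z $ i *\<^sub>R oct_e i) = z" for z
    by (simp add: vec_eq_iff oct_e_def axis_def if_distrib cong: if_cong)
  have "y \<odot> x = (\<Sum>i\<in>UNIV. \<Sum>j\<in>UNIV. (x $ i * y $ j) *\<^sub>R oct_basis_mult j i)"
    unfolding oct_mult_def by (subst sum.swap) (simp add: mult.commute)
  then have "x \<odot> y + y \<odot> x =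
      (\<Sum>i\<in>UNIV. \<Sum>j\<in>UNIV. (x $ i * y $ j) *\<^sub>R (oct_basis_mult i j + oct_basis_mult j i))"
    unfolding oct_mult_def by (simp add: sum.distrib scaleR_add_right)
  also have "\<dots> = (\<Sum>i\<in>(UNIV :: 8 set). \<Sum>j\<in>(UNIV :: 8 set). if j = 0 then (2 * y $ 0) *\<^sub>R (x $ i *\<^sub>R oct_e i) else 0)
      + (\<Sum>i\<in>(UNIV :: 8 set). \<Sum>j\<in>(UNIV :: 8 set). if i = 0 then (2 * x $ 0) *\<^sub>R (y $ j *\<^sub>R oct_e j) else 0)
      - (\<Sum>i\<in>(UNIV :: 8 set). \<Sum>j\<in>(UNIV :: 8 set). if i = j then (2 * (x $ i * y $ i)) *\<^sub>R oct_e 0 else 0)"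
    unfolding oct_basis_mult_sym sum.distrib[symmetric] sum_subtractf[symmetric]
    by (intro sum.cong refl) (auto simp: algebra_simps)
  also have "(\<Sum>i\<in>(UNIV :: 8 set). \<Sum>j\<in>(UNIV :: 8 set). if j = 0 then (2 * y $ 0) *\<^sub>R (x $ i *\<^sub>R oct_e i) else 0)
      = (2 * y $ 0) *\<^sub>R x"
    using arg_cong[OF e[of x], of "scaleR (2 * y $ 0)"] by (simp add: scaleR_sum_right)
  also have "(\<Sum>i\<in>(UNIV :: 8 set). \<Sum>j\<in>(UNIV :: 8 set). if i = 0 then (2 * x $ 0) *\<^sub>R (y $ j *\<^sub>R oct_e j) else 0)
      = (2 * x $ 0) *\<^sub>R y"
    using arg_cong[OF e[of y], of "scaleR (2 * x $ 0)"]
    by (subst sum.swap) (simp add: scaleR_sum_right)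
  also have "(\<Sum>i\<in>(UNIV :: 8 set). \<Sum>j\<in>(UNIV :: 8 set). if i = j then (2 * (x $ i * y $ i)) *\<^sub>R oct_e 0 else 0)
      = (2 * (x \<bullet> y)) *\<^sub>R oct_e 0"
    by (simp add: inner_vec_def flip: scaleR_sum_left sum_distrib_left)
  finally show ?thesis .
qed

lemma oct_square: "x \<odot> x = (2 * x $ 0) *\<^sub>R x - (x \<bullet> x) *\<^sub>R oct_e 0"
proof -
  have "2 *\<^sub>R (x \<odot> x) = 2 *\<^sub>R ((2 * x $ 0) *\<^sub>R x - (x \<bullet> x) *\<^sub>R oct_e 0)"
    using oct_mult_sym[of x x] by (simp add: scaleR_2 algebra_simps flip: scaleR_add_left)
  then show ?thesis
    by simp
qed

lemma oct_scaled_unit_eq: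
  assumes "x $ 0 = 0" "a *\<^sub>R x = b *\<^sub>R oct_e 0"
  shows "b = 0" "a = 0 \<or> x = 0"
proof -
  have "a * x $ 0 = b"
    using arg_cong[OF assms(2), of "\<lambda>z. z $ 0"] by (simp add: oct_e_def)
  then show "b = 0"
    using assms(1) by simp
  then show "a = 0 \<or> x = 0"
    using assms(2) by simp
qed

lemma G2_one:
  assumes "A \<in> G2"
  shows "A *v oct_e 0 = oct_e 0"
proof -
  obtain B where "A ** B = mat 1"
    using assms by (auto simp: G2_def invertible_def)
  then have "A *v (B *v oct_e 0) = oct_e 0"
    by (simp add: matrix_vector_mul_assoc)
  moreover have "A *v x = (A *v oct_e 0) \<odot> (A *v x)" for x
    using assms oct_mult_one(1)[of x] by (metis (mono_tags, lifting) G2_def mem_Collect_eq)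
  ultimately show ?thesis
    by (metis oct_mult_one(2))
qed

lemma G2_Im_oct:
  assumes "A \<in> G2" "x \<in> Im_oct"
  shows "A *v x \<in> Im_oct"
proof -
  define y where "y = A *v x"
  have "y \<odot> y = A *v (x \<odot> x)"
    using assms by (simp add: G2_def y_def)
  also have "x \<odot> x = - (x \<bullet> x) *\<^sub>R oct_e 0"
    using assms(2) by (simp add: oct_square Im_oct_iff)
  also have "A *v (- (x \<bullet> x) *\<^sub>R oct_e 0) = - (x \<bullet> x) *\<^sub>R oct_e 0"
    by (simp only: matrix_vector_mult_scaleR G2_one[OF assms(1)])
  finally have *: "(2 * y $ 0) *\<^sub>R y = (y \<bullet> y - x \<bullet> x) *\<^sub>R oct_e 0"
    by (simp add: oct_square[of y] algebra_simps)
  have "y $ 0 = 0"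
  proof (rule ccontr)
    assume "y $ 0 \<noteq> 0"
    define c where "c = (y \<bullet> y - x \<bullet> x) / (2 * y $ 0)"
    have "y = c *\<^sub>R oct_e 0"
      using arg_cong[OF *, of "scaleR (1 / (2 * y $ 0))"] \<open>y $ 0 \<noteq> 0\<close>
      by (simp add: c_def)
    then have "A *v x = A *v (c *\<^sub>R oct_e 0)"
      using G2_one[OF assms(1)] by (simp add: y_def matrix_vector_mult_scaleR)
    moreover obtain B where "B ** A = mat 1"
      using assms(1) by (auto simp: G2_def invertible_def)
    then have "B *v (A *v z) = z" for z
      by (simp add: matrix_vector_mul_assoc)
    ultimately have "x = c *\<^sub>R oct_e 0"
      by metis
    then have "c = 0"
      using assms(2) by (simp add: Im_oct_iff oct_e_def)
    then show False
      using \<open>y = c *\<^sub>R oct_e 0\<close> \<open>y $ 0 \<noteq> 0\<close> by simp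
  qed
  then show ?thesis
    by (simp add: y_def Im_oct_iff)
qed

lemma g2_one:
  assumes "A \<in> g2"
  shows "A *v oct_e 0 = 0"
proof -
  have "A *v (oct_e 0 \<odot> oct_e 0) = (A *v oct_e 0) \<odot> oct_e 0 + oct_e 0 \<odot> (A *v oct_e 0)"
    using assms unfolding g2_def by blast
  then show ?thesis
    by (simp add: oct_mult_one)
qed

lemma g2_Im_oct:
  assumes "A \<in> g2" "x \<in> Im_oct"
  shows "A *v x \<in> Im_oct"
proof -
  define y where "y = A *v x"
  have x0: "x $ 0 = 0"
    using assms(2) by (simp add: Im_oct_iff)
  have "y \<odot> x + x \<odot> y = A *v (x \<odot> x)"
    using assms by (simp add: g2_def y_def)
  also have "x \<odot> x = - (x \<bullet> x) *\<^sub>R oct_e 0"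
    using x0 by (simp add: oct_square)
  also have "A *v (- (x \<bullet> x) *\<^sub>R oct_e 0) = 0"
    by (simp only: matrix_vector_mult_scaleR g2_one[OF assms(1)] scaleR_zero_right)
  finally have "(2 * y $ 0) *\<^sub>R x = (2 * (y \<bullet> x)) *\<^sub>R oct_e 0"
    by (simp add: oct_mult_sym x0)
  from oct_scaled_unit_eq(2)[OF x0 this] show ?thesis
    by (auto simp: y_def Im_oct_iff)
qed

lemma oct_end_eqI:
  assumes "A *v oct_e 0 = B *v oct_e 0" "\<And>x. x \<in> Im_oct \<Longrightarrow> A *v x = B *v x"
  shows "A = B"
proof (rule matrix_eq[THEN iffD2], rule allI)
  fix x
  have "x - x $ 0 *\<^sub>R oct_e 0 \<in> Im_oct"
    by (simp add: Im_oct_iff oct_e_def)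
  from assms(2)[OF this] show "A *v x = B *v x"
    using assms(1) by (simp add: matrix_vector_mult_diff_distrib matrix_vector_mult_scaleR)
qed

lemma G2_faithful:
  assumes "A \<in> G2" "B \<in> G2" "\<And>x. x \<in> Im_oct \<Longrightarrow> A *v x = B *v x"
  shows "A = B"
  using assms by (intro oct_end_eqI) (auto simp: G2_one)

lemma g2_faithful:
  assumes "A \<in> g2" "B \<in> g2" "\<And>x. x \<in> Im_oct \<Longrightarrow> A *v x = B *v x"
  shows "A = B"
  using assms by (intro oct_end_eqI) (auto simp: g2_one)

lemma switch_involution: "switch ** switch = mat 1"
proof -
  have "(switch ** switch) *v oct_e i = mat 1 *v oct_e i" for i
  proof -
    have "i \<in> {0, 1, 2, 3, 4, 5, 6, 7}"
      using UNIV_8 by blast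
    then show ?thesis
      by (auto simp: switch_apply linear_neg[OF matrix_vector_mul_linear]
          simp flip: matrix_vector_mul_assoc)
  qed
  then have "column i (switch ** switch) = column i (mat 1)" for i
    by (simp add: oct_e_def matrix_vector_mult_basis)
  then show ?thesis
    by (simp add: column_def vec_eq_iff)
qed

end

theory Submission
  imports Defs
begin

text \<open>
  The iterated brackets of \<open>X\<close> and \<open>Y\<close> are explicit integer matrices, and fourteen of them are linearly
  independent. A derivation is determined by fourteen of its matrix entries, because \<open>e\<^sub>1, e\<^sub>2, e\<^sub>4\<close>
  generate the octonions; so these brackets are a basis of the derivation algebra.

  For the group, let \<open>H\<close> be the set of all words in the generators. The span of the conjugates \<open>h X h\<^sup>-\<^sup>1\<close>
  with \<open>h \<in> H\<close> is stable under conjugation by \<open>H\<close>; differentiating along \<open>exp (t X)\<close> makes it a Lie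
  subalgebra, so it contains all derivations. Choose a basis of conjugates \<open>h\<^sub>b X h\<^sub>b\<^sup>-\<^sup>1\<close> and a linear complement
  \<open>N\<close>. The map sending \<open>(t, n)\<close> to \<open>(\<Prod>b. h\<^sub>b exp (t\<^sub>b X) h\<^sub>b\<^sup>-\<^sup>1) (1 + n)\<close> has the identity as derivative
  at \<open>0\<close>, hence is open there, while \<open>1 + n\<close> is an automorphism for small \<open>n \<in> N\<close> only if \<open>n = 0\<close>. So \<open>H\<close>
  contains a neighbourhood of \<open>1\<close> in the automorphism group, and with it every connected subset through \<open>1\<close>.
  Circles of rotations in two orthogonal planes bring the image of \<open>e\<^sub>1\<close> and then, fixing \<open>e\<^sub>1\<close>, that of
  \<open>e\<^sub>2\<close> back to its place, and a three-sphere of automorphisms fixing \<open>e\<^sub>1, e\<^sub>2, e\<^sub>3\<close> does the same for \<open>e\<^sub>4\<close>.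
\<close>

section \<open>Octonions and matrices in coordinates\<close>

lemma forall_8: "(\<forall>i::8. P i) \<longleftrightarrow> P 0 \<and> P 1 \<and> P 2 \<and> P 3 \<and> P 4 \<and> P 5 \<and> P 6 \<and> P 7"
proof -
  have "(\<forall>i::8. P i) \<longleftrightarrow> (\<forall>i\<in>UNIV. P i)" by simp
  also have "\<dots> \<longleftrightarrow> P 0 \<and> P 1 \<and> P 2 \<and> P 3 \<and> P 4 \<and> P 5 \<and> P 6 \<and> P 7"
    unfolding UNIV_8 by simp
  finally show ?thesis .
qed

lemma sum_8: "(\<Sum>i\<in>(UNIV::8 set). f i) = f 0 + f 1 + f 2 + f 3 + f 4 + f 5 + f 6 + (f 7 :: 'a::ab_group_add)"
  unfolding UNIV_8 by (simp add: add.assoc)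

lemma oct_e_nth: "oct_e i $ j = of_bool (i = j)"
  by (simp add: oct_e_def axis_def)

lemma oct_basis_mult_nth:
  "oct_basis_mult i j $ k =
    (if i = 0 then of_bool (j = k) else if j = 0 then of_bool (i = k)
     else if i = j then - of_bool (k = 0)
     else of_bool ((i, j, k) \<in> oct_cyclic) - of_bool ((j, i, k) \<in> oct_cyclic))"
proof -
  have "(\<Sum>l\<in>(UNIV :: 8 set). f l * of_bool (l = k)) = f k" for f :: "8 \<Rightarrow> real"
    by (simp add: of_bool_def if_distrib cong: if_cong)
  then show ?thesis
    by (auto simp: oct_basis_mult_def oct_e_nth)
qed

text \<open>Solved for the third index: each imaginary unit lies in three of the seven triples, so
  each coordinate of a product receives three cyclic pairs. In this form simplification can evaluate
  membership without searching the triples.\<close>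

lemma oct_cyclic_iff:
  "(i, j, 0) \<notin> oct_cyclic"
  "(i, j, 1) \<in> oct_cyclic \<longleftrightarrow> i = 2 \<and> j = 3 \<or> i = 4 \<and> j = 5 \<or> i = 7 \<and> j = 6"
  "(i, j, 2) \<in> oct_cyclic \<longleftrightarrow> i = 3 \<and> j = 1 \<or> i = 4 \<and> j = 6 \<or> i = 5 \<and> j = 7"
  "(i, j, 3) \<in> oct_cyclic \<longleftrightarrow> i = 1 \<and> j = 2 \<or> i = 4 \<and> j = 7 \<or> i = 6 \<and> j = 5"
  "(i, j, 4) \<in> oct_cyclic \<longleftrightarrow> i = 5 \<and> j = 1 \<or> i = 6 \<and> j = 2 \<or> i = 7 \<and> j = 3"
  "(i, j, 5) \<in> oct_cyclic \<longleftrightarrow> i = 1 \<and> j = 4 \<or> i = 7 \<and> j = 2 \<or> i = 3 \<and> j = 6"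
  "(i, j, 6) \<in> oct_cyclic \<longleftrightarrow> i = 1 \<and> j = 7 \<or> i = 2 \<and> j = 4 \<or> i = 5 \<and> j = 3"
  "(i, j, 7) \<in> oct_cyclic \<longleftrightarrow> i = 6 \<and> j = 1 \<or> i = 2 \<and> j = 5 \<or> i = 3 \<and> j = 4"
  by (auto simp: oct_cyclic_def oct_triples_def)

lemma oct_mult_nth:
  "(x \<odot> y) $ 0 = x$0 * y$0 - x$1 * y$1 - x$2 * y$2 - x$3 * y$3 - x$4 * y$4 - x$5 * y$5 - x$6 * y$6 - x$7 * y$7"
  "(x \<odot> y) $ 1 = x$0 * y$1 + x$1 * y$0 + x$2 * y$3 - x$3 * y$2 + x$4 * y$5 - x$5 * y$4 - x$6 * y$7 + x$7 * y$6"
  "(x \<odot> y) $ 2 = x$0 * y$2 - x$1 * y$3 + x$2 * y$0 + x$3 * y$1 + x$4 * y$6 + x$5 * y$7 - x$6 * y$4 - x$7 * y$5"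
  "(x \<odot> y) $ 3 = x$0 * y$3 + x$1 * y$2 - x$2 * y$1 + x$3 * y$0 + x$4 * y$7 - x$5 * y$6 + x$6 * y$5 - x$7 * y$4"
  "(x \<odot> y) $ 4 = x$0 * y$4 - x$1 * y$5 - x$2 * y$6 - x$3 * y$7 + x$4 * y$0 + x$5 * y$1 + x$6 * y$2 + x$7 * y$3"
  "(x \<odot> y) $ 5 = x$0 * y$5 + x$1 * y$4 - x$2 * y$7 + x$3 * y$6 - x$4 * y$1 + x$5 * y$0 - x$6 * y$3 + x$7 * y$2"
  "(x \<odot> y) $ 6 = x$0 * y$6 + x$1 * y$7 + x$2 * y$4 - x$3 * y$5 - x$4 * y$2 + x$5 * y$3 + x$6 * y$0 - x$7 * y$1"
  "(x \<odot> y) $ 7 = x$0 * y$7 - x$1 * y$6 + x$2 * y$5 + x$3 * y$4 - x$4 * y$3 - x$5 * y$2 + x$6 * y$1 + x$7 * y$0"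
  by (simp_all add: oct_mult_def sum_8 oct_basis_mult_nth oct_cyclic_iff)

section \<open>Bilinearity of the products and the commutator\<close>

lemma bilinear_matrix_matrix_mult:
  "bilinear ((**) :: real ^ 'n ^ 'm \<Rightarrow> real ^ 'p ^ 'n \<Rightarrow> real ^ 'p ^ 'm)"
  unfolding bilinear_def
  by (auto intro!: linearI simp: vec_eq_iff matrix_matrix_mult_def algebra_simps sum.distrib sum_distrib_left)

text \<open>In finite dimension bilinearity gives boundedness; with it come the product rules for
  derivatives and the norm bounds used for curves of matrices.\<close>

interpretation matmul: bounded_bilinear "(**) :: real ^ 'n ^ 'm \<Rightarrow> real ^ 'p ^ 'n \<Rightarrow> real ^ 'p ^ 'm"
  using bilinear_matrix_matrix_mult bilinear_conv_bounded_bilinear by blast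

lemma bilinear_matrix_vector_mult:
  "bilinear ((*v) :: real ^ 'n ^ 'm \<Rightarrow> real ^ 'n \<Rightarrow> real ^ 'm)"
  unfolding bilinear_def
  by (auto intro!: linearI simp: vec_eq_iff matrix_vector_mult_def algebra_simps sum.distrib sum_distrib_left)

interpretation matvec: bounded_bilinear "(*v) :: real ^ 'n ^ 'm \<Rightarrow> real ^ 'n \<Rightarrow> real ^ 'm"
  using bilinear_matrix_vector_mult bilinear_conv_bounded_bilinear by blast

interpretation octmul: bounded_bilinear "(\<odot>)"
  using bilinear_oct_mult bilinear_conv_bounded_bilinear by blast

lemma bracket_self: "bracket A A = 0"
  and bracket_antisym: "bracket B A = - bracket A B"
  by (simp_all add: bracket_def)

lemma bracket_linear:
  "bracket (A + B) C = bracket A C + bracket B C" "bracket A (B + C) = bracket A B + bracket A C"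
  "bracket (r *\<^sub>R A) B = r *\<^sub>R bracket A B" "bracket A (r *\<^sub>R B) = r *\<^sub>R bracket A B"
  "bracket 0 A = 0" "bracket A 0 = 0"
  by (simp_all add: bracket_def matmul.add_left matmul.add_right matmul.scaleR_left matmul.scaleR_right
      matmul.zero_left matmul.zero_right scaleR_diff_right)

lemma bracket_jacobi: "bracket (bracket A B) C = bracket A (bracket B C) - bracket B (bracket A C)"
  by (simp add: bracket_def matrix_mul_assoc matmul.diff_left matmul.diff_right)

section \<open>Exact computation of iterated brackets with integer matrices\<close>

definition ix :: "8 \<Rightarrow> nat" where
  "ix i = (if i = 0 then 0 else if i = 1 then 1 else if i = 2 then 2 else if i = 3 then 3
    else if i = 4 then 4 else if i = 5 then 5 else if i = 6 then 6 else 7)"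

lemma ix_numeral: "ix 0 = 0" "ix 1 = 1" "ix 2 = 2" "ix 3 = 3" "ix 4 = 4" "ix 5 = 5" "ix 6 = 6" "ix 7 = 7"
  by (simp_all add: ix_def)

lemma ix_less: "ix i < 8"
  by (simp add: ix_def)

definition row_mat :: "int list list \<Rightarrow> oct_end"
  where "row_mat L = (\<chi> i j. of_int (L ! ix i ! ix j))"

text \<open>The commutator on integer lists, so that iterated brackets can be evaluated by code
  before passing to real matrices through \<open>bracket_row_mat\<close>.\<close>

definition row_bracket :: "int list list \<Rightarrow> int list list \<Rightarrow> int list list"
  where "row_bracket L M =
    map (\<lambda>i. map (\<lambda>j. \<Sum>k\<leftarrow>[0..<8]. L ! i ! k * M ! k ! j - M ! i ! k * L ! k ! j) [0..<8]) [0..<8]"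

lemma bracket_row_mat: "bracket (row_mat L) (row_mat M) = row_mat (row_bracket L M)"
proof -
  have "[0..<8] = [0, 1, 2, 3, 4, 5, 6, 7]"
    by (simp add: upt_conv_Cons)
  then have *: "(\<Sum>k\<leftarrow>[0..<8]. f k) = f 0 + f 1 + f 2 + f 3 + f 4 + f 5 + f 6 + f 7" for f :: "nat \<Rightarrow> int"
    by simp
  have "bracket (row_mat L) (row_mat M) $ i $ j = row_mat (row_bracket L M) $ i $ j" for i j
    using ix_less[of i] ix_less[of j]
    by (simp add: bracket_def matrix_matrix_mult_def row_mat_def row_bracket_def sum_8 ix_numeral * del: upt.simps)
  then show ?thesis
    by (simp add: vec_eq_iff)
qed

definition X_rows :: "int list list" where
  "X_rows =
    [[0, 0, 0, 0, 0, 0, 0, 0],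
     [0, 0, 2, -2, 0, 0, 0, 0],
     [0, -2, 0, 0, 0, 0, 0, 0],
     [0, 2, 0, 0, 0, 0, 0, 0],
     [0, 0, 0, 0, 0, 0, -4, -4],
     [0, 0, 0, 0, 0, 0, -2, 2],
     [0, 0, 0, 0, 4, 2, 0, 0],
     [0, 0, 0, 0, 4, -2, 0, 0]]"

definition Y_rows :: "int list list" where
  "Y_rows =
    [[0, 0, 0, 0, 0, 0, 0, 0],
     [0, 0, 0, 0, 2, -2, 0, 0],
     [0, 0, 0, 0, 0, 0, 4, 4],
     [0, 0, 0, 0, 0, 0, 2, -2],
     [0, -2, 0, 0, 0, 0, 0, 0],
     [0, 2, 0, 0, 0, 0, 0, 0],
     [0, 0, -4, -2, 0, 0, 0, 0],
     [0, 0, -4, 2, 0, 0, 0, 0]]"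

text \<open>
  The index of \<open>b\<close> counts from 1 here, but from 0 in the list. Of the seven new brackets formed from \<open>b1, ..., b5\<close>,
  \<open>[b2, b4]\<close> is missing, since it equals \<open>[b1, b5]\<close> by the Jacobi
  identity.
\<close>

definition g2_rows :: "int list list list" where
  "g2_rows = (let
      b1 = X_rows; b2 = Y_rows; b3 = row_bracket b1 b2; b4 = row_bracket b1 b3; b5 = row_bracket b2 b3;
      b6 = row_bracket b1 b4; b7 = row_bracket b1 b5; b8 = row_bracket b2 b5;
      b9 = row_bracket b3 b4; b10 = row_bracket b3 b5; b11 = row_bracket b4 b5;
      b12 = row_bracket b1 b9; b13 = row_bracket b3 b9; b14 = row_bracket b3 b10
    in [b1, b2, b3, b4, b5, b6, b7, b8, b9, b10, b11, b12, b13, b14])"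

text \<open>The positions are those of \<open>g2_coords\<close>, the fourteen entries that determine
  a derivation; on \<open>g2_rows\<close> they give a square integer matrix.\<close>

definition g2_entries :: "int list list \<Rightarrow> int list" where
  "g2_entries L = map (\<lambda>(i, j). L ! i ! j)
    [(2,1), (3,1), (4,1), (5,1), (6,1), (7,1), (3,2), (4,2), (5,2), (6,2), (7,2), (5,4), (6,4), (7,4)]"

lemma g2_entries_rows:
  "map g2_entries g2_rows =
    [[-2, 2, 0, 0, 0, 0, 0, 0, 0, 0, 0, 0, 4, 4],
     [0, 0, -2, 2, 0, 0, 0, 0, 0, -4, -4, 0, 0, 0],
     [0, 0, 0, 0, -8, -24, 0, 36, -4, 0, 0, 0, 0, 0],
     [0, 0, 208, -64, 0, 0, 0, 0, 0, 152, 200, 0, 0, 0],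
     [-208, 64, 0, 0, 0, 0, 0, 0, 0, 0, 0, 0, 152, 200],
     [0, 0, 0, 0, 1024, 1536, 0, -1824, 224, 0, 0, 0, 0, 0],
     [0, 0, 0, 0, 0, 0, 288, 0, 0, 0, 0, -288, 0, 0],
     [0, 0, 0, 0, 1024, 1536, 0, -1824, 800, 0, 0, 0, 0, 0],
     [-13760, 3776, 0, 0, 0, 0, 0, 0, 0, 0, 0, 0, 7168, 12544],
     [0, 0, -13760, 3776, 0, 0, 0, 0, 0, -7168, -12544, 0, 0, 0],
     [0, 0, 0, 0, -64256, -94464, 0, 106368, -32128, 0, 0, 0, 0, 0],
     [0, 0, 0, 0, 0, 0, 19968, 0, 0, 0, 0, -7680, 0, 0],
     [0, 0, -868864, 191488, 0, 0, 0, 0, 0, -372992, -795392, 0, 0, 0],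
     [868864, -191488, 0, 0, 0, 0, 0, 0, 0, 0, 0, 0, -372992, -795392]]"
  by code_simp

lemma oct_e_mult:
  "oct_e 4 \<odot> oct_e 6 = oct_e 2" "oct_e 6 \<odot> oct_e 4 = - oct_e 2"
  "oct_e 4 \<odot> oct_e 7 = oct_e 3" "oct_e 7 \<odot> oct_e 4 = - oct_e 3"
  "oct_e 2 \<odot> oct_e 6 = - oct_e 4" "oct_e 6 \<odot> oct_e 2 = oct_e 4"
  "oct_e 2 \<odot> oct_e 7 = - oct_e 5" "oct_e 7 \<odot> oct_e 2 = oct_e 5"
  by (simp_all add: vec_eq_iff forall_8 oct_mult_nth oct_e_nth)

lemma De_rows:
  "De 4 6 + De 4 7 = row_mat X_rows" (is ?X)
  "- (De 2 6 + De 2 7) = row_mat Y_rows" (is ?Y)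
proof -
  have "(De 4 6 + De 4 7) *v x = row_mat X_rows *v x" for x
    unfolding matrix_vector_mult_add_rdistrib oct_D_apply oct_comm_def oct_assoc_def oct_e_mult
    by (simp add: vec_eq_iff forall_8 
        oct_mult_nth oct_e_nth matrix_vector_mult_def sum_8 row_mat_def X_rows_def ix_numeral)
  then show ?X by (simp add: matrix_eq)
  have "(De 2 6 + De 2 7) *v x = (- row_mat Y_rows) *v x" for x
    unfolding matrix_vector_mult_add_rdistrib oct_D_apply oct_comm_def oct_assoc_def oct_e_mult
    by (simp add: vec_eq_iff forall_8 
        oct_mult_nth oct_e_nth matrix_vector_mult_def sum_8 row_mat_def Y_rows_def ix_numeral)
  then have "De 2 6 + De 2 7 = - row_mat Y_rows"
    by (simp add: matrix_eq)
  then show ?Y by simp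
qed

section \<open>Derivations\<close>

lemma subspace_g2: "subspace g2"
proof (rule subspaceI)
  note [simp] = bilinear_ladd[OF bilinear_oct_mult] bilinear_radd[OF bilinear_oct_mult]
    bilinear_lmul[OF bilinear_oct_mult] bilinear_rmul[OF bilinear_oct_mult]
    bilinear_lzero[OF bilinear_oct_mult] bilinear_rzero[OF bilinear_oct_mult]
  show "0 \<in> g2"
    by (simp add: g2_def)
  show "A + B \<in> g2" if "A \<in> g2" "B \<in> g2" for A B
    using that by (simp add: g2_def matrix_vector_mult_add_rdistrib)
  show "c *\<^sub>R A \<in> g2" if "A \<in> g2" for A c
    using that by (simp add: g2_def scaleR_matrix_vector_assoc[symmetric] scaleR_add_right)
qed

lemma bracket_g2:
  assumes "A \<in> g2" "B \<in> g2"
  shows "bracket A B \<in> g2"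
proof -
  note [simp] = bilinear_ladd[OF bilinear_oct_mult] bilinear_radd[OF bilinear_oct_mult]
    bilinear_lsub[OF bilinear_oct_mult] bilinear_rsub[OF bilinear_oct_mult]
  have "A *v (x \<odot> y) = (A *v x) \<odot> y + x \<odot> (A *v y)" "B *v (x \<odot> y) = (B *v x) \<odot> y + x \<odot> (B *v y)" for x y
    using assms by (simp_all add: g2_def)
  then show ?thesis
    by (simp add: g2_def bracket_def matrix_vector_mult_diff_rdistrib matrix_vector_mul_assoc[symmetric]
        matrix_vector_right_distrib)
qed

lemma matrix_nth: "(A :: oct_end) $ i $ j = (A *v oct_e j) $ i"
  by (simp add: oct_e_def matrix_vector_mult_basis column_def)

text \<open>For imaginary \<open>u\<close> and \<open>v\<close> the sum
  \<open>u \<odot> v + v \<odot> u\<close> is \<open>- 2 * (u \<bullet> v)\<close> times the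
  identity, which a derivation kills. Differentiating this relation yields skewness on imaginary
  units; row and column 0 vanish because derivations preserve \<open>Im_oct\<close>.\<close>

lemma g2_skew:
  assumes "A \<in> g2"
  shows "A $ i $ j = - A $ j $ i"
proof -
  have *: "A *v oct_e i \<in> Im_oct" if "i \<noteq> 0" for i
    using g2_Im_oct[OF assms] that by (simp add: Im_oct_iff oct_e_nth)
  have deriv: "A *v (x \<odot> y) = (A *v x) \<odot> y + x \<odot> (A *v y)" for x y
    using assms by (simp add: g2_def)
  consider "i = 0" "j = 0" | "i = 0" "j \<noteq> 0" | "i \<noteq> 0" "j = 0" | "i \<noteq> 0" "j \<noteq> 0"
    by blast
  then show ?thesis
  proof cases
    case 4
    define x y where "x = oct_e i" "y = oct_e j"
    have im: "x $ 0 = 0" "y $ 0 = 0" "(A *v x) $ 0 = 0" "(A *v y) $ 0 = 0"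
      using 4 *[of i] *[of j] by (simp_all add: x_y_def oct_e_nth Im_oct_iff)
    have "x \<odot> y + y \<odot> x = - (2 * (x \<bullet> y)) *\<^sub>R oct_e 0"
      using im by (simp add: oct_mult_sym)
    then have "A *v (x \<odot> y + y \<odot> x) = 0"
      by (simp only: matrix_vector_mult_scaleR g2_one[OF assms] scaleR_zero_right)
    then have "((A *v x) \<odot> y + y \<odot> (A *v x)) + (x \<odot> (A *v y) + (A *v y) \<odot> x) = 0"
      by (simp add: deriv matrix_vector_right_distrib algebra_simps)
    moreover have "u \<odot> v + v \<odot> u = - (2 * (u \<bullet> v)) *\<^sub>R oct_e 0" if "u $ 0 = 0" "v $ 0 = 0" for u v
      using that by (simp add: oct_mult_sym)
    ultimately have "(- (2 * ((A *v x) \<bullet> y)) - 2 * (x \<bullet> (A *v y))) *\<^sub>R oct_e 0 = 0"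
      using im by (simp add: scaleR_diff_left)
    then have "(A *v x) \<bullet> y + x \<bullet> (A *v y) = 0"
      by (simp add: oct_e_def)
    then show ?thesis
      by (simp add: x_y_def matrix_nth[of A] oct_e_def inner_axis inner_axis' add_eq_0_iff)
  qed (use * g2_one[OF assms] in \<open>auto simp: matrix_nth[of A] Im_oct_iff\<close>)
qed

text \<open>
  The entries of columns 1, 2 and 4 that are not forced by skewness or by the product \<open>e\<^sub>1 e\<^sub>2 = e\<^sub>3\<close>.
\<close>

definition g2_coords :: "(8 \<times> 8) set" where
  "g2_coords = {(2,1), (3,1), (4,1), (5,1), (6,1), (7,1), (3,2), (4,2), (5,2), (6,2), (7,2), (5,4), (6,4), (7,4)}"

text \<open>The given entries and skewness annihilate e_1 and e_2, hence their product e_3, then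
  e_4. The other units are e_1 e_4, e_2 e_4 and e_3 e_4.\<close>

lemma g2_eq_0:
  assumes A: "A \<in> g2" and coords: "\<And>i j. (i, j) \<in> g2_coords \<Longrightarrow> A $ i $ j = 0"
  shows "A = 0"
proof -
  have deriv: "A *v (x \<odot> y) = (A *v x) \<odot> y + x \<odot> (A *v y)" for x y
    using A by (simp add: g2_def)
  note [simp] = bilinear_lzero[OF bilinear_oct_mult] bilinear_rzero[OF bilinear_oct_mult]
  have prod: "A *v oct_e k = 0"
    if "oct_e i \<odot> oct_e j = oct_e k" "A *v oct_e i = 0" "A *v oct_e j = 0" for i j k
    using deriv[of "oct_e i" "oct_e j"] that by simp
  have 0: "A *v oct_e 0 = 0"
    by (rule g2_one[OF A])
  have diag: "A $ i $ i = 0" for i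
    using g2_skew[OF A, of i i] by simp
  have row0: "A $ 0 $ j = 0" for j
    using g2_skew[OF A, of 0 j] 0 by (simp add: matrix_nth[of A])
  have skew: "A $ i $ j = 0" if "A $ j $ i = 0" for i j
    using g2_skew[OF A, of i j] that by simp
  have 1: "A *v oct_e 1 = 0"
    using coords diag row0
    by (simp add: vec_eq_iff forall_8 g2_coords_def flip: matrix_nth)
  have 2: "A *v oct_e 2 = 0"
    using coords diag row0 skew
    by (simp add: vec_eq_iff forall_8 g2_coords_def flip: matrix_nth)
  have 3: "A *v oct_e 3 = 0"
    by (rule prod[OF _ 1 2]) (simp add: vec_eq_iff forall_8 oct_mult_nth oct_e_nth)
  \<comment> \<open>Entry (3,4) is the one in column 4 not covered by \<open>g2_coords\<close>, the
    diagonal, row 0 or skewness from columns 1 and 2; it comes from the vanishing of column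
    3.\<close>
  have "A $ 4 $ 3 = 0"
    by (simp add: matrix_nth[of A] 3)
  then have 4: "A *v oct_e 4 = 0"
    using coords diag row0 skew
    by (simp add: vec_eq_iff forall_8 g2_coords_def flip: matrix_nth)
  have 5: "A *v oct_e 5 = 0"
    by (rule prod[OF _ 1 4]) (simp add: vec_eq_iff forall_8 oct_mult_nth oct_e_nth)
  have 6: "A *v oct_e 6 = 0"
    by (rule prod[OF _ 2 4]) (simp add: vec_eq_iff forall_8 oct_mult_nth oct_e_nth)
  have 7: "A *v oct_e 7 = 0"
    by (rule prod[OF _ 3 4]) (simp add: vec_eq_iff forall_8 oct_mult_nth oct_e_nth)
  have "\<forall>j. A *v oct_e j = 0"
    unfolding forall_8 using 0 1 2 3 4 5 6 7 by simp
  then show ?thesis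
    by (simp add: vec_eq_iff matrix_nth[of A])
qed

text \<open>Keeping only the entries in \<open>g2_coords\<close> is a linear map, injective on
  \<open>g2\<close> by \<open>g2_eq_0\<close>, with image spanned by at most fourteen matrix
  units.\<close>

lemma dim_g2_le: "dim g2 \<le> 14"
proof -
  define E :: "8 \<times> 8 \<Rightarrow> oct_end" where "E = (\<lambda>(i, j). axis i (axis j 1))"
  define f :: "oct_end \<Rightarrow> oct_end" where "f A = (\<Sum>p\<in>g2_coords. A $ fst p $ snd p *\<^sub>R E p)" for A
  have E: "E p $ i $ j = (if p = (i, j) then 1 else 0)" for p i j
    by (cases p) (auto simp: E_def axis_def)
  have fin: "finite g2_coords" "card g2_coords \<le> 14"
    by (simp_all add: g2_coords_def)
  have f: "linear f"
    unfolding f_def by (rule linearI) (simp_all add: scaleR_add_left sum.distrib scaleR_sum_right)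
  have nth: "f A $ i $ j = A $ i $ j" if "(i, j) \<in> g2_coords" for A i j
  proof -
    have "f A $ i $ j = (\<Sum>p\<in>g2_coords. if p = (i, j) then A $ i $ j else 0)"
      unfolding f_def sum_component vector_scaleR_component
      by (rule sum.cong) (auto simp: E)
    then show ?thesis
      using that fin by simp
  qed
  have "inj_on f g2"
  proof (rule linear_inj_on_iff_eq_0[OF f subspace_g2, THEN iffD2], intro ballI impI)
    fix A assume "A \<in> g2" "f A = 0"
    then show "A = 0"
      using nth[of _ _ A] by (intro g2_eq_0) auto
  qed
  then have "dim g2 = dim (f ` g2)"
    using dim_image_eq[OF f, of g2] by (simp add: span_eq_iff[THEN iffD2, OF subspace_g2])
  also have "\<dots> \<le> card (E ` g2_coords)"
  proof (rule dim_le_card)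
    show "f ` g2 \<subseteq> span (E ` g2_coords)"
      unfolding f_def by (intro image_subsetI span_sum span_scale span_base imageI)
  qed (simp add: fin)
  also have "\<dots> \<le> 14"
    using card_image_le[OF fin(1), of E] fin(2) by simp
  finally show ?thesis .
qed

lemma row_mat_X_rows_nth:
  "(row_mat X_rows *v x) $ 0 = 0"
  "(row_mat X_rows *v x) $ 1 = 2 * x $ 2 - 2 * x $ 3"
  "(row_mat X_rows *v x) $ 2 = - 2 * x $ 1"
  "(row_mat X_rows *v x) $ 3 = 2 * x $ 1"
  "(row_mat X_rows *v x) $ 4 = - 4 * x $ 6 - 4 * x $ 7"
  "(row_mat X_rows *v x) $ 5 = 2 * x $ 7 - 2 * x $ 6"
  "(row_mat X_rows *v x) $ 6 = 4 * x $ 4 + 2 * x $ 5"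
  "(row_mat X_rows *v x) $ 7 = 4 * x $ 4 - 2 * x $ 5"
  by (simp_all add: matrix_vector_mult_def sum_8 row_mat_def ix_numeral X_rows_def)

lemma row_mat_Y_rows_nth:
  "(row_mat Y_rows *v x) $ 0 = 0"
  "(row_mat Y_rows *v x) $ 1 = 2 * x $ 4 - 2 * x $ 5"
  "(row_mat Y_rows *v x) $ 2 = 4 * x $ 6 + 4 * x $ 7"
  "(row_mat Y_rows *v x) $ 3 = 2 * x $ 6 - 2 * x $ 7"
  "(row_mat Y_rows *v x) $ 4 = - 2 * x $ 1"
  "(row_mat Y_rows *v x) $ 5 = 2 * x $ 1"
  "(row_mat Y_rows *v x) $ 6 = - 4 * x $ 2 - 2 * x $ 3"
  "(row_mat Y_rows *v x) $ 7 = 2 * x $ 3 - 4 * x $ 2"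
  by (simp_all add: matrix_vector_mult_def sum_8 row_mat_def ix_numeral Y_rows_def)

lemma rows_mem_g2: "row_mat X_rows \<in> g2" "row_mat Y_rows \<in> g2"
proof -
  show "row_mat X_rows \<in> g2"
    unfolding g2_def mem_Collect_eq vec_eq_iff forall_8
    by (simp only: row_mat_X_rows_nth oct_mult_nth vector_add_component) (simp add: algebra_simps)
  show "row_mat Y_rows \<in> g2"
    unfolding g2_def mem_Collect_eq vec_eq_iff forall_8
    by (simp only: row_mat_Y_rows_nth oct_mult_nth vector_add_component) (simp add: algebra_simps)
qed

section \<open>The Lie algebra generated by X and Y\<close>

text \<open>Independence is a property of sets, so for an indexed family the absence of repetitions
  has to be shown as well; both follow from the vanishing of coefficients.\<close>

lemma independent_family:
  fixes b :: "nat \<Rightarrow> 'a::real_vector"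
  assumes "\<And>c i. (\<Sum>i<n. c i *\<^sub>R b i) = 0 \<Longrightarrow> i < n \<Longrightarrow> c i = 0"
  shows "inj_on b {..<n}" "independent (b ` {..<n})"
proof -
  show inj: "inj_on b {..<n}"
  proof (rule inj_onI, rule ccontr)
    fix i j assume ij: "i \<in> {..<n}" "j \<in> {..<n}" "b i = b j" "i \<noteq> j"
    \<comment> \<open>A repeated vector would give the nontrivial relation
      \<open>b i - b j = 0\<close>.\<close>
    define c :: "nat \<Rightarrow> real" where "c k = (if k = i then 1 else 0) - (if k = j then 1 else 0)" for k
    have "(\<Sum>k<n. c k *\<^sub>R b k) = (\<Sum>k<n. if k = i then b k else 0) - (\<Sum>k<n. if k = j then b k else 0)"
      unfolding sum_subtractf[symmetric] by (rule sum.cong) (auto simp: c_def)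
    also have "\<dots> = 0"
      using ij by simp
    finally have "c i = 0"
      using assms ij by blast
    then show False
      using ij by (simp add: c_def)
  qed
  show "independent (b ` {..<n})"
  proof (rule independent_if_scalars_zero)
    fix f x assume sum: "(\<Sum>x\<in>b ` {..<n}. f x *\<^sub>R x) = 0" and "x \<in> b ` {..<n}"
    then obtain i where i: "i < n" "x = b i" by auto
    have "(\<Sum>i<n. f (b i) *\<^sub>R b i) = 0"
      using sum by (simp add: sum.reindex[OF inj])
    then show "f x = 0"
      using assms[of "\<lambda>i. f (b i)" i] i by simp
  qed simp
qed

definition g2_basis :: "nat \<Rightarrow> oct_end" where
  "g2_basis n = row_mat (g2_rows ! n)"

lemma g2_basis_bracket:
  "bracket (g2_basis 0) (g2_basis 1) = g2_basis 2"
  "bracket (g2_basis 0) (g2_basis 2) = g2_basis 3"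
  "bracket (g2_basis 1) (g2_basis 2) = g2_basis 4"
  "bracket (g2_basis 0) (g2_basis 3) = g2_basis 5"
  "bracket (g2_basis 0) (g2_basis 4) = g2_basis 6"
  "bracket (g2_basis 1) (g2_basis 4) = g2_basis 7"
  "bracket (g2_basis 2) (g2_basis 3) = g2_basis 8"
  "bracket (g2_basis 2) (g2_basis 4) = g2_basis 9"
  "bracket (g2_basis 3) (g2_basis 4) = g2_basis 10"
  "bracket (g2_basis 0) (g2_basis 8) = g2_basis 11"
  "bracket (g2_basis 2) (g2_basis 8) = g2_basis 12"
  "bracket (g2_basis 2) (g2_basis 9) = g2_basis 13"
  by (simp_all add: g2_basis_def bracket_row_mat g2_rows_def Let_def)

text \<open>In the Jacobi identity for indices 0, 1, 2 the left side is the bracket of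
  \<open>g2_basis 2\<close> with itself, which is zero, so the two terms on the right agree.\<close>

lemma g2_basis_bracket_1_3: "bracket (g2_basis 1) (g2_basis 3) = g2_basis 6"
  using bracket_jacobi[of "g2_basis 0" "g2_basis 1" "g2_basis 2"]
  by (simp add: g2_basis_bracket bracket_self del: One_nat_def)

text \<open>Lets single rows be read off the table \<open>g2_entries_rows\<close> without evaluating
  the nested brackets again.\<close>

lemma g2_basis_entries:
  assumes "n < 14"
  shows "g2_entries (g2_rows ! n) = map g2_entries g2_rows ! n"
proof -
  have "length g2_rows = 14"
    by (simp add: g2_rows_def Let_def)
  with assms show ?thesis by simp
qed

lemma g2_basis_independent:
  shows inj_g2_basis: "inj_on g2_basis {..<14}"
    and independent_g2_basis: "independent (g2_basis ` {..<14})"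
proof -
  have "c i = 0" if sum: "(\<Sum>i<14. c i *\<^sub>R g2_basis i) = 0" and "i < 14" for c and i :: nat
  proof -
    have entry: "(\<Sum>n<14. c n * of_int (g2_rows ! n ! ix i ! ix j)) = 0" for i j
      using arg_cong[OF sum, of "\<lambda>A. A $ i $ j"] by (simp add: sum_component g2_basis_def row_mat_def)
    note rows = g2_basis_entries[unfolded g2_entries_rows, unfolded g2_entries_def list.map prod.case]
    note rows' = rows[of 0, simplified] rows[of 1, simplified] rows[of 2, simplified] rows[of 3, simplified]
      rows[of 4, simplified] rows[of 5, simplified] rows[of 6, simplified] rows[of 7, simplified] rows[of 8, simplified]
      rows[of 9, simplified] rows[of 10, simplified] rows[of 11, simplified] rows[of 12, simplified] rows[of 13, simplified]
    have sum_14: "(\<Sum>n<14. f n) = f 0 + f 1 + f 2 + f 3 + f 4 + f 5 + f 6 + f 7 + f 8 + f 9 + f 10 + f 11 + f 12 + f 13"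
      for f :: "nat \<Rightarrow> real"
      by (simp add: eval_nat_numeral)
    note e = entry[of 2 1] entry[of 3 1] entry[of 4 1] entry[of 5 1] entry[of 6 1] entry[of 7 1]
      entry[of 3 2] entry[of 4 2] entry[of 5 2] entry[of 6 2] entry[of 7 2]
      entry[of 5 4] entry[of 6 4] entry[of 7 4]
    note e' = e[unfolded ix_numeral sum_14 One_nat_def, simplified rows', simplified]
    \<comment> \<open>The system splits into four blocks with disjoint sets of entries, of sizes 4,
      2, 4 and 4. A block collects the brackets with equal parities of the number of factors
      \<open>X\<close> and of factors \<open>Y\<close>.\<close>
    have "c 2 = 0" "c 5 = 0" "c 7 = 0" "c 10 = 0"
      using e' by linarith+
    moreover have "c 6 = 0" "c 11 = 0"
      using e' by linarith+
    moreover have "c 0 = 0" "c 4 = 0" "c 8 = 0" "c 13 = 0"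
      using e' by linarith+
    moreover have "c (Suc 0) = 0" "c 3 = 0" "c 9 = 0" "c 12 = 0"
      using e' by linarith+
    ultimately show "c i = 0"
      using \<open>i < 14\<close> by (auto simp: eval_nat_numeral less_Suc_eq)
  qed
  note zero = this
  show "inj_on g2_basis {..<14}"
    by (rule independent_family(1)) (use zero in blast)
  show "independent (g2_basis ` {..<14})"
    by (rule independent_family(2)) (use zero in blast)
qed

lemma bracket_mem_span:
  assumes "subspace W" "\<And>a b. a \<in> B \<Longrightarrow> b \<in> B \<Longrightarrow> bracket a b \<in> W" "p \<in> span B" "q \<in> span B"
  shows "bracket p q \<in> W"
proof -
  note sub = subspace_0[OF \<open>subspace W\<close>] subspace_add[OF \<open>subspace W\<close>] subspace_scale[OF \<open>subspace W\<close>]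
  have "bracket p b \<in> W" if "b \<in> B" for b
    using \<open>p \<in> span B\<close>
  proof (rule span_induct)
    show "subspace {x. bracket x b \<in> W}"
      using sub by (auto intro!: subspaceI simp: bracket_linear)
  qed (use assms(2) that in auto)
  note * = this
  show ?thesis
    using \<open>q \<in> span B\<close>
  proof (rule span_induct)
    show "subspace {x. bracket p x \<in> W}"
      using sub by (auto intro!: subspaceI simp: bracket_linear)
  qed (use * in auto)
qed

section \<open>The filtration and its dimensions\<close>

lemma zero_mem_lie_filt: "0 \<in> lie_filt X Y r"
proof (induction r)
  case (Suc r)
  then have "0 + 0 \<in> lie_filt X Y (Suc r)"
    unfolding lie_filt.simps using span_zero by blast
  then show ?case
    by simp
qed (simp add: span_zero)

lemma lie_filt_SucI:
  "A \<in> lie_filt X Y r \<Longrightarrow> B \<in> span {bracket P Q | P Q. P \<in> lie_filt X Y r \<and> Q \<in> lie_filt X Y r}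
    \<Longrightarrow> A + B \<in> lie_filt X Y (Suc r)"
  unfolding lie_filt.simps by blast

lemma lie_filt_mono: "lie_filt X Y r \<subseteq> lie_filt X Y (Suc r)"
proof
  fix A assume "A \<in> lie_filt X Y r"
  from lie_filt_SucI[OF this span_zero] show "A \<in> lie_filt X Y (Suc r)"
    by simp
qed

lemma bracket_mem_lie_filt:
  assumes "P \<in> lie_filt X Y r" "Q \<in> lie_filt X Y r"
  shows "bracket P Q \<in> lie_filt X Y (Suc r)"
proof -
  have "bracket P Q \<in> span {bracket P Q | P Q. P \<in> lie_filt X Y r \<and> Q \<in> lie_filt X Y r}"
    using assms by (intro span_base) blast
  from lie_filt_SucI[OF zero_mem_lie_filt this] show ?thesis
    by simp
qed

text \<open>By bilinearity a step of the filtration is spanned by the old generators and their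
  pairwise brackets, which reduces it to a finite computation when \<open>B\<close> is
  finite.\<close>

lemma lie_filt_Suc_span:
  assumes "lie_filt X Y r = span B"
  shows "lie_filt X Y (Suc r) = span (B \<union> {bracket P Q | P Q. P \<in> B \<and> Q \<in> B})"
proof -
  have "span {bracket P Q | P Q. P \<in> span B \<and> Q \<in> span B} = span {bracket P Q | P Q. P \<in> B \<and> Q \<in> B}"
  proof (intro span_eq[THEN iffD2] conjI)
    show "{bracket P Q | P Q. P \<in> span B \<and> Q \<in> span B} \<subseteq> span {bracket P Q | P Q. P \<in> B \<and> Q \<in> B}"
    proof clarify
      fix P Q assume PQ: "P \<in> span B" "Q \<in> span B"
      show "bracket P Q \<in> span {bracket P Q | P Q. P \<in> B \<and> Q \<in> B}"
        by (rule bracket_mem_span[OF subspace_span _ PQ], rule span_base) blast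
    qed
    have "{bracket P Q | P Q. P \<in> B \<and> Q \<in> B} \<subseteq> {bracket P Q | P Q. P \<in> span B \<and> Q \<in> span B}"
      using span_superset[of B] by blast
    also have "\<dots> \<subseteq> span \<dots>"
      by (rule span_superset)
    finally show "{bracket P Q | P Q. P \<in> B \<and> Q \<in> B} \<subseteq> span {bracket P Q | P Q. P \<in> span B \<and> Q \<in> span B}" .
  qed
  then show ?thesis
    unfolding lie_filt.simps assms span_Un by (simp only:)
qed

text \<open>Antisymmetry leaves only the brackets with \<open>i < j\<close>. Assumption
  \<open>mem\<close> bounds the new step from above, and \<open>ex\<close> produces every new basis
  element as a bracket of old ones.\<close>

lemma lie_filt_Suc_g2_basis:
  assumes "lie_filt X Y r = span (g2_basis ` {..<m})" "m \<le> n"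
    and mem: "\<And>i j. i < j \<Longrightarrow> j < m \<Longrightarrow> bracket (g2_basis i) (g2_basis j) \<in> g2_basis ` {..<n}"
    and ex: "\<And>k. m \<le> k \<Longrightarrow> k < n \<Longrightarrow> \<exists>i<m. \<exists>j<m. g2_basis k = bracket (g2_basis i) (g2_basis j)"
  shows "lie_filt X Y (Suc r) = span (g2_basis ` {..<n})"
  unfolding lie_filt_Suc_span[OF assms(1)]
proof (intro span_eq[THEN iffD2] conjI)
  have "bracket (g2_basis i) (g2_basis j) \<in> span (g2_basis ` {..<n})" if "i < m" "j < m" for i j
  proof (cases i j rule: linorder_cases)
    case less
    then show ?thesis
      using that by (intro span_base mem)
  next
    case equal
    then show ?thesis
      by (simp add: bracket_self span_zero)
  next
    case greater
    have "- bracket (g2_basis j) (g2_basis i) \<in> span (g2_basis ` {..<n})"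
      using that greater by (intro span_neg span_base mem)
    then show ?thesis
      by (simp only: bracket_antisym[of "g2_basis i" "g2_basis j"])
  qed
  then show "g2_basis ` {..<m} \<union> {bracket P Q |P Q. P \<in> g2_basis ` {..<m} \<and> Q \<in> g2_basis ` {..<m}}
      \<subseteq> span (g2_basis ` {..<n})"
    using \<open>m \<le> n\<close> by (auto intro: span_base)
  show "g2_basis ` {..<n} \<subseteq> span (g2_basis ` {..<m} \<union> {bracket P Q |P Q. P \<in> g2_basis ` {..<m} \<and> Q \<in> g2_basis ` {..<m}})"
  proof (intro image_subsetI span_base)
    fix k assume "k \<in> {..<n}"
    then show "g2_basis k \<in> g2_basis ` {..<m} \<union> {bracket P Q |P Q. P \<in> g2_basis ` {..<m} \<and> Q \<in> g2_basis ` {..<m}}"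
      using ex[of k] by (cases "k < m") auto
  qed
qed

lemma dim_span_g2_basis: "n \<le> 14 \<Longrightarrow> dim (span (g2_basis ` {..<n})) = n"
proof -
  assume "n \<le> 14"
  then have sub: "{..<n} \<subseteq> {..<14}"
    by auto
  have "dim (span (g2_basis ` {..<n})) = card (g2_basis ` {..<n})"
    unfolding dim_span
    by (rule dim_eq_card_independent, rule independent_mono[OF independent_g2_basis]) (use sub in auto)
  also have "\<dots> = n"
    using card_image[OF inj_on_subset[OF inj_g2_basis sub]] by simp
  finally show ?thesis .
qed

context
  fixes X Y :: oct_end
  assumes X: "X = g2_basis 0" and Y: "Y = g2_basis 1"
begin

lemma X_Y_mem_g2: "X \<in> g2" "Y \<in> g2"
  using rows_mem_g2 by (simp_all add: X Y g2_basis_def g2_rows_def Let_def)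

lemma lie_filt_0: "lie_filt X Y 0 = span (g2_basis ` {..<2})"
proof -
  have "{..<2} = {0, 1::nat}" by auto
  then show ?thesis by (simp add: X Y)
qed

lemma lie_filt_1: "lie_filt X Y 1 = span (g2_basis ` {..<3})"
  unfolding One_nat_def
proof (rule lie_filt_Suc_g2_basis[OF lie_filt_0])
  fix i j :: nat
  assume "i < j" "j < 2"
  then have "i = 0" "j = 1" by auto
  then show "bracket (g2_basis i) (g2_basis j) \<in> g2_basis ` {..<3}"
    using g2_basis_bracket by simp
next
  fix k :: nat
  assume "2 \<le> k" "k < 3"
  then have "k = 2" by auto
  then show "\<exists>i<2. \<exists>j<2. g2_basis k = bracket (g2_basis i) (g2_basis j)"
    using g2_basis_bracket(1) by (metis pos2 one_less_numeral_iff semiring_norm(76))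
qed simp

lemma lie_filt_2: "lie_filt X Y 2 = span (g2_basis ` {..<5})"
  unfolding numeral_2_eq_2
proof (rule lie_filt_Suc_g2_basis[OF lie_filt_1[unfolded One_nat_def]])
  fix i j :: nat
  assume "i < j" "j < 3"
  then consider "i = 0" "j = 1" | "i = 0" "j = 2" | "i = 1" "j = 2" by linarith
  then show "bracket (g2_basis i) (g2_basis j) \<in> g2_basis ` {..<5}"
    by cases (simp_all only: g2_basis_bracket, auto)
next
  fix k :: nat
  assume "3 \<le> k" "k < 5"
  then consider "k = 3" | "k = 4" by linarith
  then show "\<exists>i<3. \<exists>j<3. g2_basis k = bracket (g2_basis i) (g2_basis j)"
  proof cases
    case 1 show ?thesis by (rule exI[of _ 0], simp, rule exI[of _ 2]) (simp add: 1 g2_basis_bracket)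
  next
    case 2 show ?thesis by (rule exI[of _ 1], simp, rule exI[of _ 2]) (simp add: 2 g2_basis_bracket[unfolded One_nat_def])
  qed
qed simp

lemma lie_filt_3: "lie_filt X Y 3 = span (g2_basis ` {..<11})"
  unfolding numeral_3_eq_3
proof (rule lie_filt_Suc_g2_basis[OF lie_filt_2[unfolded numeral_2_eq_2]])
  fix i j :: nat
  assume "i < j" "j < 5"
  then consider "i = 0" "j = 1" | "i = 0" "j = 2" | "i = 1" "j = 2" | "i = 0" "j = 3" | "i = 1" "j = 3" | "i = 2" "j = 3"
    | "i = 0" "j = 4" | "i = 1" "j = 4" | "i = 2" "j = 4" | "i = 3" "j = 4"
  proof -
    have "i \<in> {0, 1, 2, 3}" "j \<in> {1, 2, 3, 4}"
      using \<open>i < j\<close> \<open>j < 5\<close> by auto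
    then show thesis
      using \<open>i < j\<close> that by auto
  qed
  \<comment> \<open>Three of the ten pairs return old elements, and two of the other seven give the
    same bracket, so six new elements appear: 5 + 6 = 11.\<close>
  then show "bracket (g2_basis i) (g2_basis j) \<in> g2_basis ` {..<11}"
    by cases (simp_all only: g2_basis_bracket g2_basis_bracket_1_3, auto)
next
  fix k :: nat
  assume "5 \<le> k" "k < 11"
  then consider "k = 5" | "k = 6" | "k = 7" | "k = 8" | "k = 9" | "k = 10" by linarith
  then show "\<exists>i<5. \<exists>j<5. g2_basis k = bracket (g2_basis i) (g2_basis j)"
  proof cases
    case 1 show ?thesis by (rule exI[of _ 0], simp, rule exI[of _ 3]) (simp add: 1 g2_basis_bracket)
  next
    case 2 show ?thesis by (rule exI[of _ 0], simp, rule exI[of _ 4]) (simp add: 2 g2_basis_bracket)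
  next
    case 3 show ?thesis by (rule exI[of _ 1], simp, rule exI[of _ 4]) (simp add: 3 g2_basis_bracket[unfolded One_nat_def])
  next
    case 4 show ?thesis by (rule exI[of _ 2], simp, rule exI[of _ 3]) (simp add: 4 g2_basis_bracket)
  next
    case 5 show ?thesis by (rule exI[of _ 2], simp, rule exI[of _ 4]) (simp add: 5 g2_basis_bracket)
  next
    case 6 show ?thesis by (rule exI[of _ 3], simp, rule exI[of _ 4]) (simp add: 6 g2_basis_bracket)
  qed
qed simp

lemma lie_filt_subset:
  assumes "lie_subalgebra L" "X \<in> L" "Y \<in> L"
  shows "lie_filt X Y r \<subseteq> L"
proof (induction r)
  case 0
  have "span {X, Y} \<subseteq> L"
    using assms by (intro span_minimal) (simp_all add: lie_subalgebra_def)
  then show ?case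
    by simp
next
  case (Suc r)
  have "span {bracket P Q |P Q. P \<in> lie_filt X Y r \<and> Q \<in> lie_filt X Y r} \<subseteq> L"
    using assms(1) Suc by (intro span_minimal) (auto simp: lie_subalgebra_def)
  moreover have "A + B \<in> L" if "A \<in> L" "B \<in> L" for A B
    using assms(1) that by (simp add: lie_subalgebra_def subspace_add)
  ultimately show ?case
    using Suc by (simp only: lie_filt.simps) blast
qed

lemma lie_subalgebra_g2: "lie_subalgebra g2"
  by (simp add: lie_subalgebra_def subspace_g2 bracket_g2)

lemma lie_filt_subset_g2: "lie_filt X Y r \<subseteq> g2"
  by (rule lie_filt_subset[OF lie_subalgebra_g2 X_Y_mem_g2])

text \<open>The fourth step need not be computed as a span: its last three basis elements are
  brackets from the third step, and \<open>dim_g2_le\<close> supplies the upper bound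
  afterwards.\<close>

lemma span_g2_basis_14: "span (g2_basis ` {..<14}) \<subseteq> lie_filt X Y 4"
proof -
  have filt_3: "g2_basis i \<in> lie_filt X Y 3" if "i < 11" for i
    unfolding lie_filt_3 using that by (intro span_base) simp
  have four: "4 = Suc 3"
    by simp
  have br: "bracket (g2_basis i) (g2_basis j) \<in> lie_filt X Y 4" if "i < 11" "j < 11" for i j
    unfolding four using bracket_mem_lie_filt[OF filt_3 filt_3, OF that] .
  have "g2_basis k \<in> lie_filt X Y 4" if "k < 14" for k
  proof -
    consider "k < 11" | "k = 11" | "k = 12" | "k = 13"
      using \<open>k < 14\<close> by linarith
    then show ?thesis
    proof cases
      case 1
      then show ?thesis
        using filt_3 lie_filt_mono[of X Y 3] by auto
    qed (use br[of 0 8] br[of 2 8] br[of 2 9] in \<open>simp_all add: g2_basis_bracket\<close>)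
  qed
  moreover have "subspace (lie_filt X Y 4)"
    using lie_filt_Suc_span[OF lie_filt_3] by (simp add: eval_nat_numeral)
  ultimately show ?thesis
    by (intro span_minimal) auto
qed

lemma span_g2_basis: "span (g2_basis ` {..<14}) = g2"
proof (rule subspace_dim_equal)
  show "span (g2_basis ` {..<14}) \<subseteq> g2"
    using span_g2_basis_14 lie_filt_subset_g2 by blast
  show "dim g2 \<le> dim (span (g2_basis ` {..<14}))"
    using dim_g2_le dim_span_g2_basis[of 14] by simp
qed (simp_all add: subspace_g2)

lemma lie_filt_4: "lie_filt X Y 4 = g2"
  using span_g2_basis_14 lie_filt_subset_g2 span_g2_basis by blast

lemma lie_filt_5: "lie_filt X Y 5 = g2"
  using lie_filt_subset_g2[of 5] lie_filt_mono[of X Y 4] lie_filt_4 by simp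

lemma Lie_eq_g2: "Lie {X, Y} = g2"
proof
  show "Lie {X, Y} \<subseteq> g2"
    unfolding Lie_def by (rule hull_minimal) (use X_Y_mem_g2 lie_subalgebra_g2 in auto)
  show "g2 \<subseteq> Lie {X, Y}"
    unfolding Lie_def hull_def using lie_filt_subset[of _ 4] lie_filt_4 by blast
qed

end

section \<open>Matrix exponential\<close>

abbreviation mat_pow :: "oct_end \<Rightarrow> nat \<Rightarrow> oct_end" where
  "mat_pow A n \<equiv> ((**) A ^^ n) (mat 1)"

lemma mat_pow_scaleR: "mat_pow (t *\<^sub>R A) n = t ^ n *\<^sub>R mat_pow A n"
  by (induction n) (simp_all add: matmul.scaleR_left matmul.scaleR_right)

text \<open>The matrix norm is submultiplicative up to a constant \<open>K\<close>, so the series is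
  compared with the real exponential series at \<open>\<bar>t\<bar> * (norm A * K)\<close>.\<close>

lemma summable_mat_exp: "summable (\<lambda>n. (t ^ n / fact n) *\<^sub>R mat_pow A n)"
proof -
  obtain K where K: "0 \<le> K" "\<And>(B :: oct_end) (C :: oct_end). norm (B ** C) \<le> norm B * norm C * K"
    using matmul.nonneg_bounded by blast
  have bound: "norm (mat_pow A n) \<le> norm (mat 1 :: oct_end) * (norm A * K) ^ n" for n
  proof (induction n)
    case (Suc n)
    have "norm (mat_pow A (Suc n)) \<le> norm A * norm (mat_pow A n) * K"
      using K(2)[of A "mat_pow A n"] by simp
    also have "\<dots> \<le> norm A * (norm (mat 1 :: oct_end) * (norm A * K) ^ n) * K"
      using Suc K(1) by (intro mult_right_mono mult_left_mono) auto
    finally show ?case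
      by (simp add: mult_ac)
  qed simp
  show ?thesis
  proof (rule summable_comparison_test')
    show "summable (\<lambda>n. norm (mat 1 :: oct_end) * (inverse (fact n) * (\<bar>t\<bar> * (norm A * K)) ^ n))"
      by (intro summable_mult summable_exp)
    fix n
    have "norm ((t ^ n / fact n) *\<^sub>R mat_pow A n) \<le> \<bar>t ^ n / fact n\<bar> * (norm (mat 1 :: oct_end) * (norm A * K) ^ n)"
      using bound[of n] by (simp add: mult_left_mono divide_right_mono)
    also have "\<dots> = norm (mat 1 :: oct_end) * (inverse (fact n) * (\<bar>t\<bar> * (norm A * K)) ^ n)"
      by (simp add: power_abs power_mult_distrib field_simps)
    finally show "norm ((t ^ n / fact n) *\<^sub>R mat_pow A n) \<le> norm (mat 1 :: oct_end) * (inverse (fact n) * (\<bar>t\<bar> * (norm A * K)) ^ n)" .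
  qed
qed

lemma mat_exp_scaleR: "mat_exp (t *\<^sub>R A) = (\<Sum>n. (t ^ n / fact n) *\<^sub>R mat_pow A n)"
  by (simp add: mat_exp_def mat_pow_scaleR divide_inverse mult.commute)

lemma mat_exp_0: "mat_exp 0 = mat 1"
proof -
  have "mat_exp 0 = (\<Sum>n. (0 ^ n / fact n) *\<^sub>R mat_pow 0 n)"
    using mat_exp_scaleR[of 0 0] by simp
  also have "\<dots> = (\<Sum>n\<in>{0}. (0 ^ n / fact n) *\<^sub>R mat_pow 0 n)"
    by (rule suminf_finite) (auto simp: power_0_left)
  finally show ?thesis
    by simp
qed

text \<open>Pairing with a fixed \<open>b\<close> gives a real power series that converges
  everywhere and can be differentiated termwise; the components are then reassembled.\<close>

lemma has_vector_derivative_mat_exp: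
  "((\<lambda>t. mat_exp (t *\<^sub>R A)) has_vector_derivative A ** mat_exp (t *\<^sub>R A)) (at t)"
proof -
  have "((\<lambda>t. mat_exp (t *\<^sub>R A) \<bullet> b) has_field_derivative (A ** mat_exp (t *\<^sub>R A)) \<bullet> b) (at t)" for b
  proof -
    define c where "c n = (mat_pow A n \<bullet> b) / fact n" for n
    have sums: "(\<lambda>n. c n * s ^ n) sums (mat_exp (s *\<^sub>R A) \<bullet> b)" for s
      using bounded_linear.sums[OF bounded_linear_inner_left summable_sums[OF summable_mat_exp[of s A]], of b]
      by (simp add: mat_exp_scaleR c_def mult.commute)
    have "(\<lambda>n. (A ** ((t ^ n / fact n) *\<^sub>R mat_pow A n)) \<bullet> b) sums ((A ** mat_exp (t *\<^sub>R A)) \<bullet> b)"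
      unfolding mat_exp_scaleR
      by (intro bounded_linear.sums[OF bounded_linear_inner_left] bounded_linear.sums[OF matmul.bounded_linear_right]
          summable_sums summable_mat_exp)
    moreover have "(A ** ((t ^ n / fact n) *\<^sub>R mat_pow A n)) \<bullet> b = diffs c n * t ^ n" for n
      by (simp add: matmul.scaleR_right c_def diffs_def del: of_nat_Suc)
    ultimately have "(\<Sum>n. diffs c n * t ^ n) = (A ** mat_exp (t *\<^sub>R A)) \<bullet> b"
      by (simp add: sums_iff)
    moreover have "((\<lambda>t. \<Sum>n. c n * t ^ n) has_field_derivative (\<Sum>n. diffs c n * t ^ n)) (at t)"
      using sums by (intro termdiffs_strong_converges_everywhere) (auto simp: sums_iff)
    ultimately show ?thesis
      using sums by (simp add: sums_iff)
  qed
  then have "((\<lambda>t. mat_exp (t *\<^sub>R A) \<bullet> b) has_derivative (\<lambda>h. (h *\<^sub>R (A ** mat_exp (t *\<^sub>R A))) \<bullet> b)) (at t)" for b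
    unfolding has_field_derivative_def by (rule has_derivative_eq_rhs) (simp add: fun_eq_iff)
  then show ?thesis
    unfolding has_vector_derivative_def
    by (subst has_derivative_componentwise_within) blast
qed

text \<open>For skew \<open>A\<close> the vector \<open>A *v x\<close> is orthogonal to
  \<open>x\<close>, so the squared norm along the flow has derivative zero. This serves both as
  injectivity of the flow and as uniqueness of the solution starting at 0.\<close>

lemma skew_flow_norm:
  fixes w :: "real \<Rightarrow> octonion"
  assumes skew: "\<And>i j. A $ i $ j = - A $ j $ i"
    and w: "\<And>t. (w has_vector_derivative A *v w t) (at t)"
  shows "norm (w t) = norm (w 0)"
proof -
  have "transpose A = - A"
    by (simp add: transpose_def vec_eq_iff) (metis skew)
  then have "x v* A = - (A *v x)" for x
    using transpose_matrix_vector[of A x] by (simp add: matvec.minus_left)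
  then have zero: "x \<bullet> (A *v x) = 0" for x
    using dot_lmul_matrix[of x A x] inner_commute[of "A *v x" x] by simp
  have "((\<lambda>t. w t \<bullet> w t) has_field_derivative 0) (at t)" for t
    using bounded_bilinear.has_vector_derivative[OF bounded_bilinear_inner w[of t] w[of t]]
    by (simp add: zero inner_commute[of "A *v w t"] has_real_derivative_iff_has_vector_derivative)
  then have "w t \<bullet> w t = w 0 \<bullet> w 0"
    by (intro DERIV_isconst_all) auto
  then show ?thesis
    by (simp add: norm_eq_sqrt_inner)
qed

lemma has_vector_derivative_mat_exp_apply:
  "((\<lambda>t. mat_exp (t *\<^sub>R A) *v x) has_vector_derivative A *v (mat_exp (t *\<^sub>R A) *v x)) (at t)"
  using bounded_linear.has_vector_derivative[OF matvec.bounded_linear_left has_vector_derivative_mat_exp]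
  by (simp add: matrix_vector_mul_assoc)

lemma mat_exp_mem_G2:
  assumes "A \<in> g2"
  shows "mat_exp (t *\<^sub>R A) \<in> G2"
proof -
  let ?E = "\<lambda>t. mat_exp (t *\<^sub>R A)"
  have "norm (?E t *v x) = norm x" for x
    using skew_flow_norm[OF g2_skew[OF assms] has_vector_derivative_mat_exp_apply, of t x]
    by (simp add: mat_exp_0)
  then have "x = 0" if "?E t *v x = 0" for x
    using that by (metis norm_eq_zero)
  then have "invertible (?E t)"
    using matrix_left_invertible_ker invertible_left_inverse by blast
  moreover have "?E t *v (x \<odot> y) = (?E t *v x) \<odot> (?E t *v y)" for x y
  proof -
    \<comment> \<open>The failure of multiplicativity satisfies the same linear flow equation,
      because \<open>A\<close> is a derivation, and starts at 0.\<close>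
    define w where "w t = ?E t *v (x \<odot> y) - (?E t *v x) \<odot> (?E t *v y)" for t
    have "(w has_vector_derivative A *v w t) (at t)" for t
    proof -
      have "A *v w t = A *v (?E t *v (x \<odot> y))
          - ((?E t *v x) \<odot> (A *v (?E t *v y)) + (A *v (?E t *v x)) \<odot> (?E t *v y))"
        using assms by (simp add: w_def g2_def matvec.diff_right add.commute)
      then show ?thesis
        unfolding w_def
        by (simp only:) (intro has_vector_derivative_diff octmul.has_vector_derivative has_vector_derivative_mat_exp_apply)
    qed
    from skew_flow_norm[OF g2_skew[OF assms] this] have "norm (w t) = norm (w 0)" .
    then show ?thesis
      by (simp add: w_def mat_exp_0)
  qed
  ultimately show ?thesis
    by (simp add: G2_def)
qed

section \<open>Subgroups of the automorphism group\<close>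

lemma matrix_inv_unique:
  assumes "A ** B = mat 1" "B ** A = mat 1"
  shows "matrix_inv (A :: real ^ 'n ^ 'n) = B"
proof -
  have "A ** matrix_inv A = mat 1 \<and> matrix_inv A ** A = mat 1"
    unfolding matrix_inv_def by (rule someI[where x = B]) (use assms in simp)
  then have "matrix_inv A = matrix_inv A ** (A ** B)" "(matrix_inv A ** A) ** B = B"
    using assms by simp_all
  then show ?thesis
    by (simp only: matrix_mul_assoc)
qed

lemma G2_mult: "A \<in> G2 \<Longrightarrow> B \<in> G2 \<Longrightarrow> A ** B \<in> G2"
  by (simp add: G2_def invertible_mult flip: matrix_vector_mul_assoc)

lemma mat_1_mem_G2: "mat 1 \<in> G2"
  by (auto simp: G2_def invertible_def)

text \<open>An imaginary \<open>y\<close> has square \<open>- (y \<bullet> y)\<close> times the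
  identity, which an automorphism fixes, so norms of imaginary parts are preserved. The real part is
  fixed and orthogonal to them.\<close>

lemma G2_norm:
  assumes "A \<in> G2"
  shows "norm (A *v x) = norm x"
proof -
  define y where "y = x - x $ 0 *\<^sub>R oct_e 0"
  have y: "y $ 0 = 0" "(A *v y) $ 0 = 0"
    using G2_Im_oct[OF assms, of y] by (simp_all add: y_def Im_oct_iff oct_e_def)
  have "(A *v y) \<odot> (A *v y) = A *v (y \<odot> y)"
    using assms by (simp add: G2_def)
  also have "y \<odot> y = - (y \<bullet> y) *\<^sub>R oct_e 0"
    using y by (simp add: oct_square)
  also have "A *v (- (y \<bullet> y) *\<^sub>R oct_e 0) = - (y \<bullet> y) *\<^sub>R oct_e 0"
    by (simp only: matrix_vector_mult_scaleR G2_one[OF assms])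
  finally have "((A *v y) \<bullet> (A *v y) - y \<bullet> y) *\<^sub>R oct_e 0 = 0"
    using y by (simp add: oct_square scaleR_diff_left)
  then have norm_y: "(A *v y) \<bullet> (A *v y) = y \<bullet> y"
    by (simp add: oct_e_def)
  have split: "(z + c *\<^sub>R oct_e 0) \<bullet> (z + c *\<^sub>R oct_e 0) = z \<bullet> z + c\<^sup>2" if "z $ 0 = 0" for z c
    using that by (simp add: inner_add oct_e_def inner_axis inner_axis' power2_eq_square)
  have "A *v x = A *v y + x $ 0 *\<^sub>R oct_e 0"
    using G2_one[OF assms] by (simp add: y_def matvec.diff_right matvec.scaleR_right)
  moreover have "x = y + x $ 0 *\<^sub>R oct_e 0"
    by (simp add: y_def)
  ultimately have "(A *v x) \<bullet> (A *v x) = x \<bullet> x"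
    using split[OF y(1)] split[OF y(2)] norm_y by metis
  then show ?thesis
    by (simp add: norm_eq_sqrt_inner)
qed

lemma G2_inner:
  assumes "A \<in> G2"
  shows "(A *v x) \<bullet> (A *v y) = x \<bullet> y"
proof -
  have "orthogonal_transformation ((*v) A)"
    by (simp add: orthogonal_transformation G2_norm[OF assms])
  then show ?thesis
    by (simp add: orthogonal_transformation_def)
qed

text \<open>Norm preservation makes automorphisms orthogonal; from here on \<open>transpose\<close>
  plays the part of the inverse.\<close>

lemma G2_transpose:
  assumes "A \<in> G2"
  shows "transpose A ** A = mat 1" "A ** transpose A = mat 1" "matrix_inv A = transpose A" "transpose A \<in> G2"
proof -
  have "orthogonal_transformation ((*v) A)"
    by (simp add: orthogonal_transformation G2_norm[OF assms])
  then have "orthogonal_matrix A"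
    by (simp add: orthogonal_transformation_matrix)
  then show inv: "transpose A ** A = mat 1" "A ** transpose A = mat 1"
    by (simp_all add: orthogonal_matrix_def)
  then show "matrix_inv A = transpose A"
    by (intro matrix_inv_unique)
  have cancel: "transpose A *v (A *v z) = z" "A *v (transpose A *v z) = z" for z
    by (simp_all only: matrix_vector_mul_assoc inv matrix_vector_mul_lid)
  have "transpose A *v (x \<odot> y) = (transpose A *v x) \<odot> (transpose A *v y)" for x y
  proof -
    have "A *v ((transpose A *v x) \<odot> (transpose A *v y)) = x \<odot> y"
      using assms by (simp add: G2_def cancel del: transpose_matrix_vector)
    then show ?thesis
      by (metis cancel(1))
  qed
  moreover have "invertible (transpose A)"
    unfolding invertible_def using inv by blast
  ultimately show "transpose A \<in> G2"
    by (simp add: G2_def)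
qed

section \<open>Conjugation and the span of the conjugates of X\<close>

lemma bounded_linear_transpose: "bounded_linear (transpose :: real ^ 'n ^ 'm \<Rightarrow> real ^ 'm ^ 'n)"
  by (intro linear_conv_bounded_linear[THEN iffD1] linearI) (simp_all add: transpose_def vec_eq_iff)

text \<open>For \<open>h\<close> in \<open>G2\<close> this is the adjoint action, with the transpose
  standing for the inverse.\<close>

definition oct_conj :: "oct_end \<Rightarrow> oct_end \<Rightarrow> oct_end" where
  "oct_conj h A = h ** A ** transpose h"

lemma linear_oct_conj: "linear (oct_conj h)"
  by (rule linearI) (simp_all add: oct_conj_def matmul.add_left matmul.add_right matmul.scaleR_left matmul.scaleR_right)

lemma oct_conj_mult: "oct_conj g (oct_conj h A) = oct_conj (g ** h) A"
  by (simp add: oct_conj_def matrix_transpose_mul matrix_mul_assoc)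

lemma oct_conj_bracket:
  assumes "h \<in> G2"
  shows "oct_conj h (bracket A B) = bracket (oct_conj h A) (oct_conj h B)"
proof -
  have *: "oct_conj h A ** oct_conj h B = oct_conj h (A ** B)" for A B
  proof -
    have "oct_conj h A ** oct_conj h B = h ** A ** (transpose h ** h) ** B ** transpose h"
      by (simp only: oct_conj_def matrix_mul_assoc)
    then show ?thesis
      by (simp add: oct_conj_def G2_transpose(1)[OF assms] matrix_mul_assoc)
  qed
  show ?thesis
    by (simp add: bracket_def * linear_diff[OF linear_oct_conj])
qed

text \<open>The difference quotients lie in the subspace, and closedness keeps their limit
  there.\<close>

lemma closed_has_vector_derivative:
  fixes f :: "real \<Rightarrow> 'a::real_normed_vector"
  assumes f: "(f has_vector_derivative D) (at 0)" and W: "subspace W" "closed W" "\<And>t. f t \<in> W"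
  shows "D \<in> W"
proof -
  have "((\<lambda>t. (f t - f 0) /\<^sub>R t) \<longlongrightarrow> D) (at 0)"
  proof (rule LIM_zero_cancel, rule tendsto_norm_zero_cancel)
    have "((\<lambda>t. norm ((f t - f 0 - t *\<^sub>R D) /\<^sub>R \<bar>t\<bar>)) \<longlongrightarrow> 0) (at 0)"
      using f by (intro tendsto_norm_zero) (simp add: has_vector_derivative_def has_derivative_at_within)
    moreover have "norm ((f t - f 0 - t *\<^sub>R D) /\<^sub>R \<bar>t\<bar>) = norm ((f t - f 0) /\<^sub>R t - D)" if "t \<noteq> 0" for t
    proof -
      have "(f t - f 0) /\<^sub>R t - D = (f t - f 0 - t *\<^sub>R D) /\<^sub>R t"
        using that by (simp add: scaleR_diff_right)
      then show ?thesis
        by simp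
    qed
    then have "\<forall>\<^sub>F t in at 0. norm ((f t - f 0 - t *\<^sub>R D) /\<^sub>R \<bar>t\<bar>) = norm ((f t - f 0) /\<^sub>R t - D)"
      by (simp add: eventually_at_filter)
    ultimately show "((\<lambda>t. norm ((f t - f 0) /\<^sub>R t - D)) \<longlongrightarrow> 0) (at 0)"
      by (rule Lim_transform_eventually)
  qed
  moreover have "(f t - f 0) /\<^sub>R t \<in> W" for t
    using W by (intro subspace_scale subspace_diff)
  ultimately show ?thesis
    by (intro Lim_in_closed_set[OF W(2) always_eventually]) auto
qed

text \<open>Closure under inverses is expressed by \<open>transpose\<close>, which inverts elements
  of \<open>G2\<close>.\<close>

locale G2_subgroup =
  fixes H :: "oct_end set"
  assumes subset_G2: "H \<subseteq> G2"
    and one_mem: "mat 1 \<in> H"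
    and mult_mem: "A \<in> H \<Longrightarrow> B \<in> H \<Longrightarrow> A ** B \<in> H"
    and transpose_mem: "A \<in> H \<Longrightarrow> transpose A \<in> H"
begin

definition Ad_span :: "oct_end \<Rightarrow> oct_end set" where
  "Ad_span X = span ((\<lambda>h. oct_conj h X) ` H)"

lemma oct_conj_mem_Ad_span:
  assumes "h \<in> H" "A \<in> Ad_span X"
  shows "oct_conj h A \<in> Ad_span X"
proof -
  have "oct_conj h ` Ad_span X = span (oct_conj h ` (\<lambda>h. oct_conj h X) ` H)"
    by (simp add: Ad_span_def linear_span_image[OF linear_oct_conj])
  also have "\<dots> \<subseteq> Ad_span X"
    unfolding Ad_span_def using assms(1) by (intro span_mono) (auto simp: oct_conj_mult intro: mult_mem)
  finally show ?thesis
    using assms(2) by blast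
qed

text \<open>The bracket is the derivative at 0 of the conjugates of \<open>A\<close> by
  \<open>mat_exp (t *\<^sub>R X)\<close>, a curve inside the closed subspace
  \<open>Ad_span X\<close>.\<close>

lemma bracket_mem_Ad_span:
  assumes X: "X \<in> g2" and exp: "\<And>t. mat_exp (t *\<^sub>R X) \<in> H" and A: "A \<in> Ad_span X"
  shows "bracket X A \<in> Ad_span X"
proof (rule closed_has_vector_derivative)
  let ?E = "\<lambda>t. mat_exp (t *\<^sub>R X)"
  have tX: "transpose X = - X"
    by (simp add: transpose_def vec_eq_iff) (metis g2_skew[OF X])
  have E: "(?E has_vector_derivative X) (at 0)"
    using has_vector_derivative_mat_exp[of X 0] by (simp add: mat_exp_0)
  have E': "((\<lambda>t. transpose (?E t)) has_vector_derivative - X) (at 0)"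
    using bounded_linear.has_vector_derivative[OF bounded_linear_transpose E] by (simp add: tX)
  show "((\<lambda>t. oct_conj (?E t) A) has_vector_derivative bracket X A) (at 0)"
    using matmul.has_vector_derivative[OF matmul.has_vector_derivative[OF E has_vector_derivative_const[of A]] E']
    by (simp add: oct_conj_def mat_exp_0 transpose_mat bracket_def matmul.minus_right matmul.zero_right)
  show "oct_conj (?E t) A \<in> Ad_span X" for t
    by (rule oct_conj_mem_Ad_span[OF exp A])
qed (simp_all add: Ad_span_def closed_subspace)

text \<open>Conjugating by the inverse of \<open>h\<close> reduces the bracket with
  \<open>oct_conj h X\<close> to a bracket with \<open>X\<close>; linearity in the first argument
  does the rest.\<close>

lemma lie_subalgebra_Ad_span:
  assumes X: "X \<in> g2" and exp: "\<And>t. mat_exp (t *\<^sub>R X) \<in> H"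
  shows "lie_subalgebra (Ad_span X)"
  unfolding lie_subalgebra_def
proof (intro conjI ballI)
  show sub: "subspace (Ad_span X)"
    by (simp add: Ad_span_def)
  fix A B assume A: "A \<in> Ad_span X" and B: "B \<in> Ad_span X"
  have "bracket (oct_conj h X) B \<in> Ad_span X" if h: "h \<in> H" for h
  proof -
    have hG: "h \<in> G2"
      using h subset_G2 by blast
    have "B = oct_conj h (oct_conj (transpose h) B)"
      by (simp add: oct_conj_mult G2_transpose(2)[OF hG]) (simp add: oct_conj_def transpose_mat)
    then have "bracket (oct_conj h X) B = oct_conj h (bracket X (oct_conj (transpose h) B))"
      using oct_conj_bracket[OF hG] by metis
    also have "\<dots> \<in> Ad_span X"
      using h B by (intro oct_conj_mem_Ad_span bracket_mem_Ad_span X exp transpose_mem)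
    finally show ?thesis .
  qed
  note gen = this
  show "bracket A B \<in> Ad_span X"
    using A unfolding Ad_span_def[of X]
  proof (rule span_induct)
    show "subspace {A. bracket A B \<in> span ((\<lambda>h. oct_conj h X) ` H)}"
      by (auto intro!: subspaceI simp: bracket_linear span_zero span_add span_scale)
  qed (use gen in \<open>auto simp: Ad_span_def\<close>)
qed

end

text \<open>Multiplicativity of \<open>mat 1 + n\<close> expands to \<open>f n = Q n n\<close>,
  where \<open>f\<close> measures the failure of \<open>n\<close> to be a derivation. On
  \<open>N\<close> the linear map \<open>f\<close> is injective, hence bounded below by a multiple
  of \<open>norm n\<close>, while \<open>Q n n\<close> is quadratically small.\<close>

lemma G2_transversal:
  assumes N: "subspace N" "N \<inter> g2 \<subseteq> {0}"
  shows "\<exists>e>0. \<forall>n\<in>N. norm n < e \<longrightarrow> mat 1 + n \<in> G2 \<longrightarrow> n = 0"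
proof -
  define f :: "oct_end \<Rightarrow> octonion ^ 8 ^ 8" where
    "f n = (\<chi> i j. n *v (oct_e i \<odot> oct_e j) - ((n *v oct_e i) \<odot> oct_e j + oct_e i \<odot> (n *v oct_e j)))" for n
  define Q :: "oct_end \<Rightarrow> oct_end \<Rightarrow> octonion ^ 8 ^ 8" where
    "Q n m = (\<chi> i j. (n *v oct_e i) \<odot> (m *v oct_e j))" for n m
  have "bounded_linear f"
    unfolding linear_conv_bounded_linear[symmetric] f_def
    by (rule linearI) (simp_all add: vec_eq_iff matvec.add_left matvec.scaleR_left octmul.add_left octmul.add_right
        octmul.scaleR_left octmul.scaleR_right algebra_simps)
  have "bounded_bilinear Q"
    unfolding bilinear_conv_bounded_bilinear[symmetric] bilinear_def Q_def
    by (auto intro!: linearI simp: vec_eq_iff matvec.add_left matvec.scaleR_left octmul.add_left octmul.add_right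
        octmul.scaleR_left octmul.scaleR_right)
  then obtain K where K: "K > 0" "\<And>n m. norm (Q n m) \<le> norm n * norm m * K"
    using bounded_bilinear.pos_bounded by blast
  have "n = 0" if "n \<in> N" "f n = 0" for n
  proof -
    have bil: "bilinear (\<lambda>x y. n *v (x \<odot> y))" "bilinear (\<lambda>x y. (n *v x) \<odot> y + x \<odot> (n *v y))"
      unfolding bilinear_def
      by (auto intro!: linearI simp: matvec.add_right matvec.scaleR_right octmul.add_left octmul.add_right
        octmul.scaleR_left octmul.scaleR_right scaleR_add_right)
    have "(\<lambda>x y. n *v (x \<odot> y)) = (\<lambda>x y. (n *v x) \<odot> y + x \<odot> (n *v y))"
    proof (rule bilinear_eq_stdbasis[OF bil])
      fix x y :: octonion
      assume "x \<in> Basis" "y \<in> Basis"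
      then obtain i j where "x = oct_e i" "y = oct_e j"
        by (auto simp: Basis_vec_def oct_e_def)
      moreover have "f n $ i $ j = 0"
        using that(2) by simp
      ultimately show "n *v (x \<odot> y) = (n *v x) \<odot> y + x \<odot> (n *v y)"
        by (simp add: f_def)
    qed
    then have "n \<in> g2"
      by (simp add: g2_def fun_eq_iff)
    then show ?thesis
      using that(1) N(2) by blast
  qed
  then obtain c where c: "c > 0" "\<And>n. n \<in> N \<Longrightarrow> c * norm n \<le> norm (f n)"
    using injective_imp_isometric[OF closed_subspace[OF N(1)] N(1) \<open>bounded_linear f\<close>] by blast
  show ?thesis
  proof (intro exI conjI ballI impI)
    show "c / K > 0"
      using c(1) K(1) by simp
    fix n assume n: "n \<in> N" "norm n < c / K" "mat 1 + n \<in> G2"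
    have "(mat 1 + n) *v (x \<odot> y) = ((mat 1 + n) *v x) \<odot> ((mat 1 + n) *v y)" for x y
      using n(3) by (simp add: G2_def)
    then have "n *v (x \<odot> y) - ((n *v x) \<odot> y + x \<odot> (n *v y)) = (n *v x) \<odot> (n *v y)" for x y
      by (simp add: matvec.add_left octmul.add_left octmul.add_right algebra_simps)
    then have "f n = Q n n"
      by (simp add: f_def Q_def)
    then have "c * norm n \<le> norm n * norm n * K"
      using c(2)[OF n(1)] K(2)[of n n] by simp
    then have "norm n * (c - norm n * K) \<le> 0"
      by (simp add: algebra_simps)
    moreover have "c - norm n * K > 0"
      using n(2) K(1) by (simp add: field_simps)
    ultimately have "norm n \<le> 0"
      by (simp add: mult_le_0_iff)
    then show "n = 0"
      by simp
  qed
qed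

text \<open>Where all factors equal the identity the product rule leaves the sum of the derivatives.
  The value at the point is carried along because the induction step uses it.\<close>

lemma has_derivative_mat_prod:
  assumes "\<And>b. b \<in> set bs \<Longrightarrow> (f b has_derivative D b) (at x)" "\<And>b. b \<in> set bs \<Longrightarrow> f b x = mat 1"
  shows "((\<lambda>n. mat_prod (map (\<lambda>b. f b n) bs)) has_derivative (\<lambda>n. \<Sum>b\<leftarrow>bs. D b n)) (at x)
    \<and> mat_prod (map (\<lambda>b. f b x) bs) = mat 1"
  using assms
proof (induction bs)
  case (Cons b bs)
  then have IH: "((\<lambda>n. mat_prod (map (\<lambda>b. f b n) bs)) has_derivative (\<lambda>n. \<Sum>b\<leftarrow>bs. D b n)) (at x)"
    "mat_prod (map (\<lambda>b. f b x) bs) = mat 1"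
    by simp_all
  have "((\<lambda>n. f b n ** mat_prod (map (\<lambda>b. f b n) bs)) has_derivative
      (\<lambda>n. f b x ** (\<Sum>b\<leftarrow>bs. D b n) + D b n ** mat_prod (map (\<lambda>b. f b x) bs))) (at x)"
    by (rule matmul.FDERIV) (use Cons.prems IH in auto)
  then show ?case
    using Cons.prems(2)[of b] IH(2) by (simp add: mat_prod_def add.commute)
qed (simp add: mat_prod_def)

lemma continuous_on_mat_prod:
  assumes "\<And>b. b \<in> set bs \<Longrightarrow> continuous_on S (f b)"
  shows "continuous_on S (\<lambda>n. mat_prod (map (\<lambda>b. f b n) bs))"
  using assms
proof (induction bs)
  case (Cons b bs)
  have "continuous_on S (\<lambda>n. f b n ** mat_prod (map (\<lambda>b. f b n) bs))"
    by (rule matmul.continuous_on) (use Cons in auto)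
  then show ?case
    by (simp add: mat_prod_def)
qed (simp add: mat_prod_def)

text \<open>Coordinates with respect to \<open>B\<close> are unique: those in \<open>C\<close>
  vanish for the first span, those outside \<open>C\<close> for the second.\<close>

lemma span_Int_span_independent:
  assumes "independent (B :: 'a::euclidean_space set)" "C \<subseteq> B"
  shows "span (B - C) \<inter> span C \<subseteq> {0}"
proof
  fix x assume x: "x \<in> span (B - C) \<inter> span C"
  have "representation B x b = 0" for b
  proof (cases "b \<in> C")
    case True
    then have "representation (B - C) x b = 0"
      using representation_ne_zero by fastforce
    then show ?thesis
      using representation_extend[OF assms(1), of x "B - C"] x by simp
  next
    case False
    then have "representation C x b = 0"
      using representation_ne_zero by fastforce
    then show ?thesis
      using representation_extend[OF assms(1), of x C] assms(2) x by simp
  qed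
  moreover have "x \<in> span B"
    using x span_mono[OF assms(2)] by blast
  ultimately have "x = 0"
    using sum_nonzero_representation_eq[OF assms(1), of x] by simp
  then show "x \<in> {0}"
    by simp
qed

lemma (in G2_subgroup) mat_prod_mem: "set ws \<subseteq> H \<Longrightarrow> mat_prod ws \<in> H"
  by (induction ws) (simp_all add: mat_prod_def one_mem mult_mem)

lemma (in G2_subgroup) contains_ball:
  assumes exp: "\<And>t. mat_exp (t *\<^sub>R X) \<in> H" and g2: "g2 \<subseteq> Ad_span X"
  shows "\<exists>e>0. \<forall>A\<in>G2. norm (A - mat 1) < e \<longrightarrow> A \<in> H"
proof -
  obtain B where B: "B \<subseteq> (\<lambda>h. oct_conj h X) ` H" "independent B" "(\<lambda>h. oct_conj h X) ` H \<subseteq> span B"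
    using maximal_independent_subset by blast
  have g2_B: "g2 \<subseteq> span B"
    using g2 B(3) unfolding Ad_span_def by (meson order_trans span_minimal subspace_span)
  obtain C where C: "B \<subseteq> C" "independent C" "span C = UNIV"
    using maximal_independent_subset_extend[OF subset_UNIV B(2)] by (metis top.extremum_uniqueI)
  have fin: "finite C" "finite B"
    using C(2) B(2) by (auto intro: independent_imp_finite)
  have "\<exists>k. \<forall>b\<in>B. k b \<in> H \<and> oct_conj (k b) X = b"
    by (rule bchoice) (use B(1) in blast)
  then obtain k where k: "\<And>b. b \<in> B \<Longrightarrow> k b \<in> H" "\<And>b. b \<in> B \<Longrightarrow> oct_conj (k b) X = b"
    by blast
  define t where "t b n = representation C n b" for b n
  have t: "bounded_linear (t b)" for b
    unfolding linear_conv_bounded_linear[symmetric] t_def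
    by (rule linearI) (simp_all add: representation_add representation_scale C(2,3))
  \<comment> \<open>The projection to \<open>span (C - B)\<close> along \<open>span B\<close>; the
    linear functionals \<open>t b\<close> are the coordinates in the basis \<open>C\<close>.\<close>
  define \<nu> where "\<nu> n = (\<Sum>b\<in>C - B. t b n *\<^sub>R b)" for n
  have \<nu>: "bounded_linear \<nu>"
    unfolding \<nu>_def by (intro bounded_linear_sum bounded_linear_compose[OF bounded_linear_scaleR_left] t)
  have decomp: "(\<Sum>b\<in>B. t b n *\<^sub>R b) + \<nu> n = n" for n
  proof -
    have "(\<Sum>b\<in>C. t b n *\<^sub>R b) = n"
      unfolding t_def using C fin by (intro sum_representation_eq) auto
    then show ?thesis
      using sum.subset_diff[OF C(1) fin(1), of "\<lambda>b. t b n *\<^sub>R b"] by (simp add: \<nu>_def add.commute)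
  qed
  have "span (C - B) \<inter> g2 \<subseteq> {0}"
    using span_Int_span_independent[OF C(2,1)] g2_B by blast
  then obtain e where e: "e > 0" "\<And>n. n \<in> span (C - B) \<Longrightarrow> norm n < e \<Longrightarrow> mat 1 + n \<in> G2 \<Longrightarrow> n = 0"
    using G2_transversal[OF subspace_span] by metis
  obtain L where L: "L > 0" "\<And>n. norm (\<nu> n) \<le> norm n * L"
    using bounded_linear.pos_bounded[OF \<nu>] by blast
  obtain bs where bs: "set bs = B" "distinct bs"
    using finite_distinct_list[OF fin(2)] by blast
  \<comment> \<open>A conjugated one-parameter subgroup with derivative
    \<open>t b n *\<^sub>R b\<close> at 0, so the derivatives of all factors of
    \<open>\<Phi>\<close> add up to the identity by \<open>decomp\<close>.\<close>
  define \<gamma> where "\<gamma> b n = oct_conj (k b) (mat_exp (t b n *\<^sub>R X))" for b n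
  define \<Phi> where "\<Phi> n = mat_prod (map (\<lambda>b. \<gamma> b n) bs) ** (mat 1 + \<nu> n)" for n
  have conj: "bounded_linear (oct_conj h)" for h
    using linear_oct_conj by (simp add: linear_conv_bounded_linear)
  have t0: "t b 0 = 0" for b
    by (rule linear_0[OF bounded_linear.linear[OF t]])
  have \<gamma>_mem: "\<gamma> b n \<in> H" if "b \<in> B" for b n
    using k(1)[OF that] by (simp add: \<gamma>_def oct_conj_def mult_mem transpose_mem exp)
  have \<gamma>0: "\<gamma> b 0 = mat 1" if "b \<in> B" for b
  proof -
    have "k b \<in> G2"
      using k(1)[OF that] subset_G2 by blast
    then show ?thesis
      by (simp add: \<gamma>_def oct_conj_def t0 mat_exp_0 G2_transpose(2))
  qed
  have "(\<gamma> b has_derivative (\<lambda>n. t b n *\<^sub>R b)) (at 0)" if "b \<in> B" for b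
  proof -
    have "((\<lambda>s. mat_exp (s *\<^sub>R X)) has_derivative (\<lambda>s. s *\<^sub>R X)) (at (t b 0))"
      using has_vector_derivative_mat_exp[of X 0] by (simp add: has_vector_derivative_def mat_exp_0 t0)
    from has_derivative_compose[OF bounded_linear_imp_has_derivative[OF t] this]
    have "((\<lambda>n. mat_exp (t b n *\<^sub>R X)) has_derivative (\<lambda>n. t b n *\<^sub>R X)) (at 0)" .
    from bounded_linear.has_derivative[OF conj[of "k b"] this]
    show ?thesis
      using k(2)[OF that] by (simp add: \<gamma>_def[abs_def] linear_scale[OF linear_oct_conj])
  qed
  from has_derivative_mat_prod[of bs \<gamma>, OF this] \<gamma>0 bs
  have prod: "((\<lambda>n. mat_prod (map (\<lambda>b. \<gamma> b n) bs)) has_derivative (\<lambda>n. \<Sum>b\<in>B. t b n *\<^sub>R b)) (at 0)"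
    "mat_prod (map (\<lambda>b. \<gamma> b 0) bs) = mat 1"
    by (simp_all add: sum_list_distinct_conv_sum_set)
  have "((\<lambda>n. mat 1 + \<nu> n) has_derivative \<nu>) (at 0)"
    using has_derivative_add[OF has_derivative_const bounded_linear_imp_has_derivative[OF \<nu>]] by simp
  from matmul.FDERIV[OF prod(1) this]
  have deriv: "(\<Phi> has_derivative (\<lambda>n. n)) (at 0)"
    using decomp by (simp add: \<Phi>_def[abs_def] prod(2) linear_0[OF bounded_linear.linear[OF \<nu>]] add.commute)
  have "continuous_on UNIV (\<gamma> b)" for b
  proof -
    have "continuous_on UNIV (\<lambda>s. mat_exp (s *\<^sub>R X))"
      using has_vector_derivative_mat_exp by (intro continuous_at_imp_continuous_on ballI has_vector_derivative_continuous)
    then have "continuous_on UNIV (\<lambda>n. mat_exp (t b n *\<^sub>R X))"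
      using continuous_on_compose2[OF _ bounded_linear.continuous_on[OF t continuous_on_id]] by blast
    then show ?thesis
      unfolding \<gamma>_def by (rule bounded_linear.continuous_on[OF conj])
  qed
  then have "continuous_on UNIV \<Phi>"
    unfolding \<Phi>_def by (intro matmul.continuous_on continuous_on_mat_prod continuous_on_add
        bounded_linear.continuous_on[OF \<nu>] continuous_on_id continuous_on_const)
  moreover have "0 \<in> interior (ball 0 (e / L))"
    using e(1) L(1) by simp
  \<comment> \<open>The open mapping theorem is applied at the point 0, with the identity as right
    inverse of the derivative.\<close>
  ultimately have "\<Phi> 0 \<in> interior (\<Phi> ` ball 0 (e / L))"
    by (intro sussmann_open_mapping[OF open_UNIV _ UNIV_I deriv bounded_linear_ident]) auto
  moreover have "\<Phi> 0 = mat 1"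
    by (simp add: \<Phi>_def prod(2) linear_0[OF bounded_linear.linear[OF \<nu>]])
  ultimately obtain r where r: "r > 0" "ball (mat 1) r \<subseteq> \<Phi> ` ball 0 (e / L)"
    by (auto simp: mem_interior)
  show ?thesis
  proof (intro exI conjI ballI impI)
    show "r > 0" by fact
    fix A assume A: "A \<in> G2" "norm (A - mat 1) < r"
    then have "A \<in> ball (mat 1) r"
      by (simp add: dist_norm norm_minus_commute)
    then obtain n where n: "norm n < e / L" "A = \<Phi> n"
      using r(2) by auto
    define F where "F = mat_prod (map (\<lambda>b. \<gamma> b n) bs)"
    have F: "F \<in> H"
      unfolding F_def by (rule mat_prod_mem) (use \<gamma>_mem bs(1) in auto)
    then have FG: "F \<in> G2"
      using subset_G2 by blast
    \<comment> \<open>Dividing by the factor in \<open>H\<close> leaves a small transversal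
      automorphism, so \<open>\<nu> n = 0\<close> and \<open>A\<close> equals
      \<open>F\<close>.\<close>
    have "transpose F ** A = mat 1 + \<nu> n"
      by (simp add: n(2) \<Phi>_def matrix_mul_assoc G2_transpose(1)[OF FG] flip: F_def)
    then have "mat 1 + \<nu> n \<in> G2"
      using G2_mult[OF G2_transpose(4)[OF FG] A(1)] by simp
    moreover have "norm (\<nu> n) < e"
      using L(2)[of n] n(1) L(1) by (simp add: field_simps)
    moreover have "\<nu> n \<in> span (C - B)"
      unfolding \<nu>_def by (intro span_sum span_scale span_base)
    ultimately have "\<nu> n = 0"
      using e(2) by blast
    then show "A \<in> H"
      using F by (simp add: n(2) \<Phi>_def flip: F_def)
  qed
qed

text \<open>The left cosets of \<open>H\<close> cut \<open>K\<close> into relatively open classes,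
  since a translate of the small ball lies in each coset. A connected \<open>K\<close> meets only
  the class of the identity.\<close>

lemma (in G2_subgroup) contains_connected:
  assumes ball: "\<exists>e>0. \<forall>A\<in>G2. norm (A - mat 1) < e \<longrightarrow> A \<in> H"
    and K: "connected K" "K \<subseteq> G2" "mat 1 \<in> K"
  shows "K \<subseteq> H"
proof
  fix A assume "A \<in> K"
  obtain e where e: "e > 0" "\<And>A. A \<in> G2 \<Longrightarrow> norm (A - mat 1) < e \<Longrightarrow> A \<in> H"
    using ball by blast
  obtain L where L: "L > 0" "\<And>(A :: oct_end) (B :: oct_end). norm (A ** B) \<le> norm A * norm B * L"
    using matmul.pos_bounded by blast
  have "transpose (mat 1) ** A \<in> H"
    using K(1) K(3) \<open>A \<in> K\<close>
  proof (rule connected_equivalence_relation[where R = "\<lambda>A B. transpose A ** B \<in> H"])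
    show "transpose B ** A \<in> H" if "transpose A ** B \<in> H" for A B
      using transpose_mem[OF that] by (simp add: matrix_transpose_mul)
    show "transpose A ** C \<in> H" if "transpose A ** B \<in> H" "transpose B ** C \<in> H" "B \<in> K" for A B C
    proof -
      have "B ** transpose B = mat 1"
        using that(3) K(2) G2_transpose(2) by blast
      then have "transpose A ** (B ** transpose B) ** C = transpose A ** C"
        by simp
      then have "transpose A ** B ** (transpose B ** C) = transpose A ** C"
        by (simp only: matrix_mul_assoc)
      then show ?thesis
        using mult_mem[OF that(1,2)] by simp
    qed
    fix A assume A: "A \<in> K"
    \<comment> \<open>Chosen so that \<open>dist A B < r\<close> puts
      \<open>transpose A ** B\<close> within \<open>e\<close> of the identity; adding 1 keeps the
      denominator positive.\<close>
    define r where "r = e / ((norm (transpose A) + 1) * L)"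
    have pos: "(norm (transpose A) + 1) * L > 0"
      using L(1) by (intro mult_pos_pos) (auto intro: add_nonneg_pos)
    have "transpose A ** B \<in> H" if B: "B \<in> K" "dist A B < r" for B
    proof (rule e(2))
      have AB: "A \<in> G2" "B \<in> G2"
        using A B K(2) by auto
      then show "transpose A ** B \<in> G2"
        by (simp add: G2_mult G2_transpose(4))
      have "transpose A ** B - mat 1 = transpose A ** (B - A)"
        by (simp add: matmul.diff_right G2_transpose(1)[OF AB(1)])
      then have "norm (transpose A ** B - mat 1) \<le> norm (transpose A) * norm (B - A) * L"
        using L(2) by simp
      also have "\<dots> \<le> (norm (transpose A) + 1) * L * norm (B - A)"
        using L(1) by (simp add: algebra_simps)
      also have "\<dots> < e"
        using B(2) pos by (simp add: r_def dist_norm norm_minus_commute field_simps)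
      finally show "norm (transpose A ** B - mat 1) < e" .
    qed
    moreover have "r > 0"
      using e(1) pos by (simp add: r_def)
    ultimately show "\<exists>T. openin (top_of_set K) T \<and> A \<in> T \<and> (\<forall>B\<in>T. transpose A ** B \<in> H)"
      using A by (intro exI[of _ "K \<inter> ball A r"]) auto
  qed
  then show "A \<in> H"
    by (simp add: transpose_mat)
qed

section \<open>Explicit automorphisms and transitivity\<close>

text \<open>
  The planes \<open>(a, b)\<close> and \<open>(p, q)\<close> are turned by opposite angles. This is an automorphism when
  \<open>e\<^sub>a e\<^sub>b = e\<^sub>p e\<^sub>q\<close>.
\<close>

definition plane_rot :: "8 \<Rightarrow> 8 \<Rightarrow> 8 \<Rightarrow> 8 \<Rightarrow> real \<Rightarrow> real \<Rightarrow> oct_end" where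
  "plane_rot a b p q c s = matrix (\<lambda>x. \<chi> i.
    if i = a then c * x $ a + s * x $ b else if i = b then c * x $ b - s * x $ a
    else if i = p then c * x $ p - s * x $ q else if i = q then c * x $ q + s * x $ p else x $ i)"

lemma plane_rot_nth:
  "(plane_rot a b p q c s *v x) $ i =
    (if i = a then c * x $ a + s * x $ b else if i = b then c * x $ b - s * x $ a
    else if i = p then c * x $ p - s * x $ q else if i = q then c * x $ q + s * x $ p else x $ i)"
proof -
  have "linear (\<lambda>x :: octonion. (\<chi> i.
    if i = a then c * x $ a + s * x $ b else if i = b then c * x $ b - s * x $ a
    else if i = p then c * x $ p - s * x $ q else if i = q then c * x $ q + s * x $ p else x $ i) :: octonion)"
    by (rule linearI) (auto simp: vec_eq_iff algebra_simps)
  then show ?thesis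
    by (simp add: plane_rot_def matrix_works)
qed

lemma continuous_on_If_const:
  "(P \<Longrightarrow> continuous_on S f) \<Longrightarrow> (\<not> P \<Longrightarrow> continuous_on S g) \<Longrightarrow> continuous_on S (\<lambda>x. if P then f x else g x)"
  by (cases P) simp_all

lemma continuous_on_plane_rot:
  "continuous_on S (\<lambda>z. plane_rot a b p q (Re z) (Im z))"
  unfolding plane_rot_def matrix_def
  by (intro continuous_on_vec_lambda, unfold vec_lambda_beta)
    (intro continuous_on_If_const continuous_intros)

text \<open>Invertibility is automatic: \<open>x\<close> times its conjugate
  \<open>(2 * x $ 0) *\<^sub>R oct_e 0 - x\<close> is the squared norm times the identity, so the
  kernel is trivial.\<close>

lemma G2_I:
  assumes mult: "\<And>x y. A *v (x \<odot> y) = (A *v x) \<odot> (A *v y)" and one: "A *v oct_e 0 = oct_e 0"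
  shows "A \<in> G2"
proof -
  have "x = 0" if "A *v x = 0" for x
  proof -
    have "x \<odot> ((2 * x $ 0) *\<^sub>R oct_e 0 - x) = (x \<bullet> x) *\<^sub>R oct_e 0"
      by (simp add: octmul.diff_right octmul.scaleR_right oct_mult_one oct_square)
    then have "(x \<bullet> x) *\<^sub>R (A *v oct_e 0) = (A *v x) \<odot> (A *v ((2 * x $ 0) *\<^sub>R oct_e 0 - x))"
      by (metis mult matvec.scaleR_right)
    then show ?thesis
      using that by (simp add: one octmul.zero_left) (simp add: oct_e_def)
  qed
  then show ?thesis
    using matrix_left_invertible_ker[of A] invertible_left_inverse[of A] mult by (auto simp: G2_def)
qed

text \<open>The common values of e_a e_b and e_p e_q are, in order, e_1, e_1, e_6, e_1, -e_5 and
  e_3. The first five rotations fix e_1; the last one turns it towards e_2.\<close>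

lemma plane_rot_mem_G2:
  assumes "c\<^sup>2 + s\<^sup>2 = 1"
  shows "plane_rot 2 3 7 6 c s \<in> G2" "plane_rot 4 5 7 6 c s \<in> G2" "plane_rot 2 4 5 3 c s \<in> G2"
    "plane_rot 7 6 4 5 c s \<in> G2" "plane_rot 2 7 6 3 c s \<in> G2" "plane_rot 1 2 4 7 c s \<in> G2"
proof -
  show "plane_rot 2 3 7 6 c s \<in> G2"
    by (rule G2_I; insert assms; simp only: vec_eq_iff forall_8 oct_mult_nth plane_rot_nth oct_e_nth; simp;
      (intro conjI)?; (simp add: algebra_simps; fail | algebra))
  show "plane_rot 4 5 7 6 c s \<in> G2"
    by (rule G2_I; insert assms; simp only: vec_eq_iff forall_8 oct_mult_nth plane_rot_nth oct_e_nth; simp;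
      (intro conjI)?; (simp add: algebra_simps; fail | algebra))
  show "plane_rot 2 4 5 3 c s \<in> G2"
    by (rule G2_I; insert assms; simp only: vec_eq_iff forall_8 oct_mult_nth plane_rot_nth oct_e_nth; simp;
      (intro conjI)?; (simp add: algebra_simps; fail | algebra))
  show "plane_rot 7 6 4 5 c s \<in> G2"
    by (rule G2_I; insert assms; simp only: vec_eq_iff forall_8 oct_mult_nth plane_rot_nth oct_e_nth; simp;
      (intro conjI)?; (simp add: algebra_simps; fail | algebra))
  show "plane_rot 2 7 6 3 c s \<in> G2"
    by (rule G2_I; insert assms; simp only: vec_eq_iff forall_8 oct_mult_nth plane_rot_nth oct_e_nth; simp;
      (intro conjI)?; (simp add: algebra_simps; fail | algebra))
  show "plane_rot 1 2 4 7 c s \<in> G2"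
    by (rule G2_I; insert assms; simp only: vec_eq_iff forall_8 oct_mult_nth plane_rot_nth oct_e_nth; simp;
      (intro conjI)?; (simp add: algebra_simps; fail | algebra))
qed

text \<open>
  In the splitting of the octonions into the quaternions spanned by \<open>1, e\<^sub>1, e\<^sub>2, e\<^sub>3\<close> and their multiples of
  \<open>e\<^sub>4\<close>, this is \<open>u + v e\<^sub>4 \<mapsto> u + (p v) e\<^sub>4\<close> for the quaternion \<open>p\<close>.
\<close>

definition quat_mult :: "complex \<times> complex \<Rightarrow> oct_end" where
  "quat_mult p = (let p0 = Re (fst p); p1 = Im (fst p); p2 = Re (snd p); p3 = Im (snd p) in
    matrix (\<lambda>x. \<chi> i.
      if i = 4 then p0 * x $ 4 - p1 * x $ 5 - p2 * x $ 6 - p3 * x $ 7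
      else if i = 5 then p0 * x $ 5 + p1 * x $ 4 + p2 * x $ 7 - p3 * x $ 6
      else if i = 6 then p0 * x $ 6 - p1 * x $ 7 + p2 * x $ 4 + p3 * x $ 5
      else if i = 7 then p0 * x $ 7 + p1 * x $ 6 - p2 * x $ 5 + p3 * x $ 4
      else x $ i))"

lemma quat_mult_nth:
  "(quat_mult (Complex p0 p1, Complex p2 p3) *v x) $ i =
    (if i = 4 then p0 * x $ 4 - p1 * x $ 5 - p2 * x $ 6 - p3 * x $ 7
      else if i = 5 then p0 * x $ 5 + p1 * x $ 4 + p2 * x $ 7 - p3 * x $ 6
      else if i = 6 then p0 * x $ 6 - p1 * x $ 7 + p2 * x $ 4 + p3 * x $ 5
      else if i = 7 then p0 * x $ 7 + p1 * x $ 6 - p2 * x $ 5 + p3 * x $ 4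
      else x $ i)"
proof -
  have "linear (\<lambda>x :: octonion. (\<chi> i.
    if i = 4 then p0 * x $ 4 - p1 * x $ 5 - p2 * x $ 6 - p3 * x $ 7
      else if i = 5 then p0 * x $ 5 + p1 * x $ 4 + p2 * x $ 7 - p3 * x $ 6
      else if i = 6 then p0 * x $ 6 - p1 * x $ 7 + p2 * x $ 4 + p3 * x $ 5
      else if i = 7 then p0 * x $ 7 + p1 * x $ 6 - p2 * x $ 5 + p3 * x $ 4
      else x $ i) :: octonion)"
    by (rule linearI) (auto simp: vec_eq_iff algebra_simps)
  then show ?thesis
    by (simp add: quat_mult_def matrix_works)
qed

lemma continuous_on_quat_mult: "continuous_on S quat_mult"
  unfolding quat_mult_def Let_def matrix_def
  by (intro continuous_on_vec_lambda, unfold vec_lambda_beta)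
    (intro continuous_on_If_const continuous_intros)

lemma quat_mult_mem_G2:
  assumes "p0\<^sup>2 + p1\<^sup>2 + p2\<^sup>2 + p3\<^sup>2 = 1"
  shows "quat_mult (Complex p0 p1, Complex p2 p3) \<in> G2"
  by (rule G2_I; insert assms; simp only: vec_eq_iff forall_8 oct_mult_nth quat_mult_nth oct_e_nth; simp;
      (intro conjI)?; (simp add: algebra_simps; fail | algebra))


lemma plane_rot_1_0: "plane_rot a b p q 1 0 = mat 1"
  by (simp add: matrix_eq vec_eq_iff plane_rot_nth)

lemma quat_mult_1: "quat_mult (1, 0) = mat 1"
proof -
  have "quat_mult (Complex 1 0, Complex 0 0) = mat 1"
    unfolding matrix_eq vec_eq_iff quat_mult_nth by simp
  moreover have "(1, 0) = (Complex 1 0, Complex 0 0)"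
    by (simp add: complex_eq_iff)
  ultimately show ?thesis
    by (simp only:)
qed

lemma rotate_to_axis:
  fixes x y :: real
  obtains c s where "c\<^sup>2 + s\<^sup>2 = 1" "c * y - s * x = 0" "c * x + s * y \<ge> 0"
proof (cases "x = 0 \<and> y = 0")
  case True
  then show ?thesis
    using that[of 1 0] by simp
next
  case False
  define r where "r = sqrt (x\<^sup>2 + y\<^sup>2)"
  have r2: "r\<^sup>2 = x\<^sup>2 + y\<^sup>2"
    by (simp add: r_def)
  have "r > 0"
    using False by (simp add: r_def sum_power2_gt_zero_iff)
  show ?thesis
  proof (rule that[of "x / r" "y / r"])
    show "(x / r)\<^sup>2 + (y / r)\<^sup>2 = 1"
      using \<open>r > 0\<close> by (simp add: power_divide flip: add_divide_distrib r2)
    show "x / r * x + y / r * y \<ge> 0"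
      using \<open>r > 0\<close> by (simp flip: add_divide_distrib)
  qed simp
qed

section \<open>Moving the images of e_1, e_2 and e_4 back by elements of the subgroup\<close>

locale G2_subgroup_connected = G2_subgroup +
  assumes contains_connected: "\<And>K. connected K \<Longrightarrow> K \<subseteq> G2 \<Longrightarrow> mat 1 \<in> K \<Longrightarrow> K \<subseteq> H"
begin

lemma plane_rot_mem:
  assumes "\<And>c s. c\<^sup>2 + s\<^sup>2 = 1 \<Longrightarrow> plane_rot a b p q c s \<in> G2" and "c\<^sup>2 + s\<^sup>2 = 1"
  shows "plane_rot a b p q c s \<in> H"
proof -
  let ?R = "\<lambda>z. plane_rot a b p q (Re z) (Im z)"
  have norm: "z \<in> sphere 0 1 \<longleftrightarrow> (Re z)\<^sup>2 + (Im z)\<^sup>2 = 1" for z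
    by (simp add: cmod_def)
  have "?R ` sphere 0 1 \<subseteq> H"
  proof (rule contains_connected)
    show "connected (?R ` sphere 0 1)"
      by (intro connected_continuous_image continuous_on_plane_rot connected_sphere) simp
    show "?R ` sphere 0 1 \<subseteq> G2"
      using assms(1) norm by blast
    show "mat 1 \<in> ?R ` sphere 0 1"
      by (rule image_eqI[of _ _ 1]) (simp_all add: plane_rot_1_0)
  qed
  moreover have "Complex c s \<in> sphere 0 1"
    using assms(2) norm by simp
  ultimately show ?thesis
    by force
qed

text \<open>Pairs of complex numbers serve as four-dimensional space, so the unit quaternions form a
  connected sphere.\<close>

lemma quat_mult_mem:
  assumes "p0\<^sup>2 + p1\<^sup>2 + p2\<^sup>2 + p3\<^sup>2 = 1"
  shows "quat_mult (Complex p0 p1, Complex p2 p3) \<in> H"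
proof -
  have norm: "(Complex p0 p1, Complex p2 p3) \<in> sphere 0 1 \<longleftrightarrow> p0\<^sup>2 + p1\<^sup>2 + p2\<^sup>2 + p3\<^sup>2 = 1" for p0 p1 p2 p3
    by (simp add: norm_prod_def cmod_def add.assoc)
  have "quat_mult ` sphere 0 1 \<subseteq> H"
  proof (rule contains_connected)
    show "connected (quat_mult ` sphere 0 1)"
      by (intro connected_continuous_image continuous_on_quat_mult connected_sphere) simp
    show "quat_mult ` sphere 0 1 \<subseteq> G2"
    proof (rule image_subsetI)
      fix p :: "complex \<times> complex"
      assume "p \<in> sphere 0 1"
      moreover obtain p0 p1 p2 p3 where p: "p = (Complex p0 p1, Complex p2 p3)"
        by (metis complex_surj surj_pair)
      ultimately have "p0\<^sup>2 + p1\<^sup>2 + p2\<^sup>2 + p3\<^sup>2 = 1"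
        using norm by simp
      then show "quat_mult p \<in> G2"
        unfolding p by (rule quat_mult_mem_G2)
    qed
    show "mat 1 \<in> quat_mult ` sphere 0 1"
      by (rule image_eqI[of _ _ "(1, 0)"]) (simp_all add: quat_mult_1 norm_prod_def)
  qed
  then show ?thesis
    using norm[of p0 p1 p2 p3] assms by blast
qed

text \<open>Besides the new zero, the conclusions record what later rotations must not destroy:
  coordinates outside both planes, a companion plane that is already zero, and fixed basis
  vectors.\<close>

lemma kill_coordinate:
  assumes G2: "\<And>c s. c\<^sup>2 + s\<^sup>2 = 1 \<Longrightarrow> plane_rot a b p q c s \<in> G2" and "a \<noteq> b"
  obtains h where "h \<in> H" "(h *v x) $ b = 0" "(h *v x) $ a \<ge> 0"
    "\<And>y i. i \<notin> {a, b, p, q} \<Longrightarrow> (h *v y) $ i = y $ i"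
    "\<And>y i. i \<in> {p, q} - {a, b} \<Longrightarrow> y $ p = 0 \<Longrightarrow> y $ q = 0 \<Longrightarrow> (h *v y) $ i = 0"
    "\<And>k. k \<notin> {a, b, p, q} \<Longrightarrow> h *v oct_e k = oct_e k"
proof -
  obtain c s where cs: "c\<^sup>2 + s\<^sup>2 = 1" "c * x $ b - s * x $ a = 0" "c * x $ a + s * x $ b \<ge> 0"
    by (rule rotate_to_axis)
  show ?thesis
    by (rule that[of "plane_rot a b p q c s"])
      (use cs \<open>a \<noteq> b\<close> plane_rot_mem[OF G2] in \<open>auto simp: plane_rot_nth vec_eq_iff oct_e_nth\<close>)
qed

text \<open>Used first for the image of e_1, then for that of e_2 once e_1 is in place. Coordinates
  3, 5, 4, 6, 7 are cleared in this order.\<close>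

lemma rotate_into_12:
  obtains h where "h \<in> H" "h *v oct_e 1 = oct_e 1" "\<And>i. i \<in> {3, 4, 5, 6, 7} \<Longrightarrow> (h *v x) $ i = 0" "(h *v x) $ 2 \<ge> 0"
proof -
  \<comment> \<open>each rotation has a companion plane in which the coordinates are still unconstrained or both already zero\<close>
  obtain h1 where h1: "h1 \<in> H" "(h1 *v x) $ 3 = 0" "\<And>y i. i \<notin> {2, 3, 7, 6} \<Longrightarrow> (h1 *v y) $ i = y $ i"
    "\<And>y i. i \<in> {7, 6} - {2, 3} \<Longrightarrow> y $ 7 = 0 \<Longrightarrow> y $ 6 = 0 \<Longrightarrow> (h1 *v y) $ i = 0"
    "h1 *v oct_e 1 = oct_e 1"
    by (rule kill_coordinate[OF plane_rot_mem_G2(1), of x]) auto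
  obtain h2 where h2: "h2 \<in> H" "(h2 *v (h1 *v x)) $ 5 = 0" "\<And>y i. i \<notin> {4, 5, 7, 6} \<Longrightarrow> (h2 *v y) $ i = y $ i"
    "\<And>y i. i \<in> {7, 6} - {4, 5} \<Longrightarrow> y $ 7 = 0 \<Longrightarrow> y $ 6 = 0 \<Longrightarrow> (h2 *v y) $ i = 0"
    "h2 *v oct_e 1 = oct_e 1"
    by (rule kill_coordinate[OF plane_rot_mem_G2(2), of "h1 *v x"]) auto
  obtain h3 where h3: "h3 \<in> H" "(h3 *v (h2 *v (h1 *v x))) $ 4 = 0" "\<And>y i. i \<notin> {2, 4, 5, 3} \<Longrightarrow> (h3 *v y) $ i = y $ i"
    "\<And>y i. i \<in> {5, 3} - {2, 4} \<Longrightarrow> y $ 5 = 0 \<Longrightarrow> y $ 3 = 0 \<Longrightarrow> (h3 *v y) $ i = 0"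
    "h3 *v oct_e 1 = oct_e 1"
    by (rule kill_coordinate[OF plane_rot_mem_G2(3), of "h2 *v (h1 *v x)"]) auto
  obtain h4 where h4: "h4 \<in> H" "(h4 *v (h3 *v (h2 *v (h1 *v x)))) $ 6 = 0" "\<And>y i. i \<notin> {7, 6, 4, 5} \<Longrightarrow> (h4 *v y) $ i = y $ i"
    "\<And>y i. i \<in> {4, 5} - {7, 6} \<Longrightarrow> y $ 4 = 0 \<Longrightarrow> y $ 5 = 0 \<Longrightarrow> (h4 *v y) $ i = 0"
    "h4 *v oct_e 1 = oct_e 1"
    by (rule kill_coordinate[OF plane_rot_mem_G2(4), of "h3 *v (h2 *v (h1 *v x))"]) auto
  obtain h5 where h5: "h5 \<in> H" "(h5 *v (h4 *v (h3 *v (h2 *v (h1 *v x))))) $ 7 = 0" "(h5 *v (h4 *v (h3 *v (h2 *v (h1 *v x))))) $ 2 \<ge> 0"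
    "\<And>y i. i \<notin> {2, 7, 6, 3} \<Longrightarrow> (h5 *v y) $ i = y $ i"
    "\<And>y i. i \<in> {6, 3} - {2, 7} \<Longrightarrow> y $ 6 = 0 \<Longrightarrow> y $ 3 = 0 \<Longrightarrow> (h5 *v y) $ i = 0"
    "h5 *v oct_e 1 = oct_e 1"
    by (rule kill_coordinate[OF plane_rot_mem_G2(5), of "h4 *v (h3 *v (h2 *v (h1 *v x)))"]) auto
  show ?thesis
  proof (rule that)
    let ?h = "h5 ** (h4 ** (h3 ** (h2 ** h1)))"
    show "?h \<in> H"
      by (intro mult_mem h1 h2 h3 h4 h5)
    show "?h *v oct_e 1 = oct_e 1"
      by (simp add: h1 h2 h3 h4 h5 flip: matrix_vector_mul_assoc)
    show "(?h *v x) $ 2 \<ge> 0"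
      using h5(3) by (simp flip: matrix_vector_mul_assoc)
    have "(?h *v x) $ 3 = 0 \<and> (?h *v x) $ 4 = 0 \<and> (?h *v x) $ 5 = 0 \<and> (?h *v x) $ 6 = 0 \<and> (?h *v x) $ 7 = 0"
      unfolding matrix_vector_mul_assoc[symmetric]
      by (simp add: h1 h2 h3 h4 h5)
    then show "(?h *v x) $ i = 0" if "i \<in> {3, 4, 5, 6, 7}" for i
      using that by auto
  qed
qed

end

lemma inner_oct_e: "x \<bullet> oct_e k = x $ k"
  by (simp add: oct_e_def inner_axis)

lemma eq_oct_eI:
  assumes "\<And>i. i \<noteq> k \<Longrightarrow> v $ i = 0" "v $ k \<ge> 0" "norm v = 1"
  shows "v = oct_e k"
proof -
  have v: "v = v $ k *\<^sub>R oct_e k"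
    using assms(1) by (auto simp: vec_eq_iff oct_e_nth)
  have "norm (v $ k *\<^sub>R oct_e k) = v $ k"
    using assms(2) by (simp add: oct_e_def)
  then have "v $ k = 1"
    using v assms(3) by metis
  then show ?thesis
    using v by simp
qed

text \<open>The three units generate: e_3 = e_1 e_2, e_5 = e_1 e_4, e_6 = e_2 e_4 and e_7 = e_3
  e_4.\<close>

lemma G2_eq_mat_1:
  assumes A: "A \<in> G2" and fixed: "A *v oct_e 1 = oct_e 1" "A *v oct_e 2 = oct_e 2" "A *v oct_e 4 = oct_e 4"
  shows "A = mat 1"
proof -
  have prod: "A *v oct_e k = oct_e k"
    if "oct_e i \<odot> oct_e j = oct_e k" "A *v oct_e i = oct_e i" "A *v oct_e j = oct_e j" for i j k
    using A that by (metis (mono_tags, lifting) G2_def mem_Collect_eq)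
  have 3: "A *v oct_e 3 = oct_e 3"
    by (rule prod[OF _ fixed(1,2)]) (simp add: vec_eq_iff forall_8 oct_mult_nth oct_e_nth)
  have 5: "A *v oct_e 5 = oct_e 5"
    by (rule prod[OF _ fixed(1,3)]) (simp add: vec_eq_iff forall_8 oct_mult_nth oct_e_nth)
  have 6: "A *v oct_e 6 = oct_e 6"
    by (rule prod[OF _ fixed(2,3)]) (simp add: vec_eq_iff forall_8 oct_mult_nth oct_e_nth)
  have 7: "A *v oct_e 7 = oct_e 7"
    by (rule prod[OF _ 3 fixed(3)]) (simp add: vec_eq_iff forall_8 oct_mult_nth oct_e_nth)
  have "\<forall>j. A *v oct_e j = oct_e j"
    unfolding forall_8 using G2_one[OF A] fixed 3 5 6 7 by simp
  then have "column j A = column j (mat 1)" for j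
    by (metis matrix_vector_mult_basis matrix_vector_mul_lid oct_e_def)
  then show ?thesis
    by (simp add: column_def vec_eq_iff)
qed

lemma norm_oct_e: "norm (oct_e k) = 1"
  by (simp add: oct_e_def)

lemma G2_nth_0:
  assumes "A \<in> G2" "k \<noteq> 0"
  shows "(A *v oct_e k) $ 0 = 0"
  using G2_Im_oct[OF assms(1), of "oct_e k"] assms(2) by (simp add: Im_oct_iff oct_e_nth)

lemma (in G2_subgroup_connected) G2_subset: "G2 \<subseteq> H"
proof
  fix A assume A: "A \<in> G2"
  obtain h1 where h1: "h1 \<in> H" "\<And>i. i \<in> {3, 4, 5, 6, 7} \<Longrightarrow> (h1 *v (A *v oct_e 1)) $ i = 0"
    by (rule rotate_into_12[of "A *v oct_e 1"]) auto
  obtain h2 where h2: "h2 \<in> H" "(h2 *v (h1 *v (A *v oct_e 1))) $ 2 = 0" "(h2 *v (h1 *v (A *v oct_e 1))) $ 1 \<ge> 0"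
    "\<And>y i. i \<notin> {1, 2, 4, 7} \<Longrightarrow> (h2 *v y) $ i = y $ i"
    "\<And>y i. i \<in> {4, 7} - {1, 2} \<Longrightarrow> y $ 4 = 0 \<Longrightarrow> y $ 7 = 0 \<Longrightarrow> (h2 *v y) $ i = 0"
    \<comment> \<open>The companion plane (4,7) is already zero, so turning the plane (1,2) keeps
      the cleared coordinates.\<close>
    by (rule kill_coordinate[OF plane_rot_mem_G2(6), of "h1 *v (A *v oct_e 1)"]) auto
  define A1 where "A1 = h2 ** (h1 ** A)"
  have A1: "A1 \<in> G2"
    unfolding A1_def using h1(1) h2(1) A subset_G2 by (intro G2_mult) auto
  have A1_1: "A1 *v oct_e 1 = oct_e 1"
  proof (rule eq_oct_eI)
    have "(A1 *v oct_e 1) $ 0 = 0"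
      by (rule G2_nth_0[OF A1]) simp
    then have "\<forall>i. i \<noteq> 1 \<longrightarrow> (A1 *v oct_e 1) $ i = 0"
      unfolding forall_8 using h2 h1(2) by (simp add: A1_def flip: matrix_vector_mul_assoc)
    then show "(A1 *v oct_e 1) $ i = 0" if "i \<noteq> 1" for i
      using that by blast
    show "(A1 *v oct_e 1) $ 1 \<ge> 0"
      using h2(3) by (simp add: A1_def flip: matrix_vector_mul_assoc)
  qed (simp add: G2_norm[OF A1] norm_oct_e)
  obtain h3 where h3: "h3 \<in> H" "h3 *v oct_e 1 = oct_e 1" "\<And>i. i \<in> {3, 4, 5, 6, 7} \<Longrightarrow> (h3 *v (A1 *v oct_e 2)) $ i = 0"
    "(h3 *v (A1 *v oct_e 2)) $ 2 \<ge> 0"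
    by (rule rotate_into_12[of "A1 *v oct_e 2"]) auto
  define A2 where "A2 = h3 ** A1"
  have A2: "A2 \<in> G2"
    unfolding A2_def using h3(1) A1 subset_G2 by (intro G2_mult) auto
  have A2_1: "A2 *v oct_e 1 = oct_e 1"
    by (simp add: A2_def A1_1 h3(2) flip: matrix_vector_mul_assoc)
  have A2_2: "A2 *v oct_e 2 = oct_e 2"
  proof (rule eq_oct_eI)
    have "(A2 *v oct_e 2) $ 0 = 0"
      by (rule G2_nth_0[OF A2]) simp
    moreover have "(A2 *v oct_e 2) $ 1 = 0"
      using G2_inner[OF A2, of "oct_e 2" "oct_e 1"] by (simp add: A2_1 inner_oct_e oct_e_nth)
    ultimately have "\<forall>i. i \<noteq> 2 \<longrightarrow> (A2 *v oct_e 2) $ i = 0"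
      unfolding forall_8 using h3(3) by (simp add: A2_def flip: matrix_vector_mul_assoc)
    then show "(A2 *v oct_e 2) $ i = 0" if "i \<noteq> 2" for i
      using that by blast
    show "(A2 *v oct_e 2) $ 2 \<ge> 0"
      using h3(4) by (simp add: A2_def flip: matrix_vector_mul_assoc)
  qed (simp add: G2_norm[OF A2] norm_oct_e)
  have "oct_e 1 \<odot> oct_e 2 = oct_e 3"
    by (simp add: vec_eq_iff forall_8 oct_mult_nth oct_e_nth)
  then have A2_3: "A2 *v oct_e 3 = oct_e 3"
    using A2 A2_1 A2_2 by (metis (mono_tags, lifting) G2_def mem_Collect_eq)
  define w where "w = A2 *v oct_e 4"
  have "w $ k = 0" if "A2 *v oct_e k = oct_e k" "k \<noteq> 4" for k
    using G2_inner[OF A2, of "oct_e 4" "oct_e k"] that by (simp add: w_def inner_oct_e oct_e_nth)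
  then have w: "w $ 0 = 0" "w $ 1 = 0" "w $ 2 = 0" "w $ 3 = 0"
    using G2_one[OF A2] A2_1 A2_2 A2_3 by simp_all
  have "w \<bullet> w = 1"
    by (simp add: w_def G2_inner[OF A2] inner_oct_e oct_e_nth)
  then have norm_w: "(w $ 4)\<^sup>2 + (w $ 5)\<^sup>2 + (w $ 6)\<^sup>2 + (w $ 7)\<^sup>2 = 1"
    by (simp add: inner_vec_def sum_8 w power2_eq_square)
  \<comment> \<open>Here \<open>w\<close> is q e_4 for the unit quaternion q with coordinates
    \<open>w $ 4\<close> to \<open>w $ 7\<close>, and \<open>h4\<close> multiplies by the conjugate
    of q, its inverse.\<close>
  define h4 where "h4 = quat_mult (Complex (w $ 4) (- w $ 5), Complex (- w $ 6) (- w $ 7))"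
  have h4: "h4 \<in> H"
    unfolding h4_def using norm_w by (intro quat_mult_mem) simp
  have h4_fixed: "h4 *v oct_e k = oct_e k" if "k \<in> {1, 2}" for k
    using that by (auto simp: vec_eq_iff forall_8 h4_def quat_mult_nth oct_e_nth)
  have "h4 *v w = oct_e 4"
    using norm_w by (simp add: vec_eq_iff forall_8 h4_def quat_mult_nth oct_e_nth w power2_eq_square)
  moreover have "h4 ** A2 \<in> G2"
    using h4 A2 subset_G2 by (intro G2_mult) auto
  ultimately have "h4 ** A2 = mat 1"
    by (intro G2_eq_mat_1) (simp_all add: A2_1 A2_2 h4_fixed w_def flip: matrix_vector_mul_assoc)
  moreover define g where "g = h4 ** h3 ** h2 ** h1"
  ultimately have "g ** A = mat 1"
    by (simp add: A2_def A1_def matrix_mul_assoc)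
  have g: "g \<in> H"
    unfolding g_def by (intro mult_mem h1 h2 h3 h4)
  then have "transpose g ** g = mat 1"
    using subset_G2 G2_transpose(1) by blast
  then have "A = transpose g ** (g ** A)"
    by (simp add: matrix_mul_assoc)
  also have "\<dots> = transpose g"
    by (simp add: \<open>g ** A = mat 1\<close>)
  finally show "A \<in> H"
    using transpose_mem[OF g] by simp
qed

section \<open>Words in the generators\<close>

lemma mat_prod_append: "mat_prod (us @ vs) = mat_prod us ** mat_prod vs"
  by (induction us) (simp_all add: mat_prod_def matrix_mul_assoc)

lemma transpose_mat_prod: "transpose (mat_prod ws) = mat_prod (rev (map transpose ws))"
proof (induction ws)
  case (Cons w ws)
  have "transpose (mat_prod (w # ws)) = transpose (mat_prod ws) ** transpose w"
    by (simp add: mat_prod_def matrix_transpose_mul)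
  also have "\<dots> = mat_prod (rev (map transpose ws)) ** mat_prod [transpose w]"
    by (simp only: Cons.IH) (simp add: mat_prod_def)
  finally show ?case
    by (simp add: mat_prod_append)
qed (simp add: mat_prod_def transpose_mat)

text \<open>Concatenating words multiplies them; reversing a word and transposing its letters
  inverts it.\<close>

lemma G2_subgroup_mat_prod:
  assumes S: "S \<subseteq> G2" "\<And>g. g \<in> S \<Longrightarrow> transpose g \<in> S"
  shows "G2_subgroup {mat_prod ws | ws. set ws \<subseteq> S}"
proof
  have "mat_prod ws \<in> G2" if "set ws \<subseteq> S" for ws
    using that S(1) by (induction ws) (auto simp: mat_prod_def mat_1_mem_G2 intro: G2_mult)
  then show "{mat_prod ws | ws. set ws \<subseteq> S} \<subseteq> G2"
    by blast
  show "mat 1 \<in> {mat_prod ws | ws. set ws \<subseteq> S}"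
    by (auto simp: mat_prod_def intro!: exI[of _ "[]"])
  show "A ** B \<in> {mat_prod ws | ws. set ws \<subseteq> S}"
    if "A \<in> {mat_prod ws | ws. set ws \<subseteq> S}" "B \<in> {mat_prod ws | ws. set ws \<subseteq> S}" for A B
  proof -
    obtain us vs where "A = mat_prod us" "B = mat_prod vs" "set us \<subseteq> S" "set vs \<subseteq> S"
      using \<open>A \<in> _\<close> \<open>B \<in> _\<close> by blast
    then have "A ** B = mat_prod (us @ vs)" "set (us @ vs) \<subseteq> S"
      by (simp_all add: mat_prod_append)
    then show ?thesis
      by blast
  qed
  show "transpose A \<in> {mat_prod ws | ws. set ws \<subseteq> S}"
    if "A \<in> {mat_prod ws | ws. set ws \<subseteq> S}" for A
  proof -
    obtain ws where "A = mat_prod ws" "set ws \<subseteq> S"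
      using \<open>A \<in> _\<close> by blast
    then have "transpose A = mat_prod (rev (map transpose ws))" "set (rev (map transpose ws)) \<subseteq> S"
      using S(2) by (auto simp: transpose_mat_prod)
    then show ?thesis
      by blast
  qed
qed

text \<open>Both \<open>X\<close> and \<open>Y\<close> are conjugates of \<open>X\<close> by
  elements of \<open>H\<close>, so the Lie subalgebra \<open>Ad_span X\<close> contains
  \<open>g2\<close>; the neighbourhood, connectedness and transitivity results then apply in
  turn.\<close>

lemma (in G2_subgroup) eq_G2_if_Lie:
  assumes X: "X \<in> g2" and exp: "\<And>t. mat_exp (t *\<^sub>R X) \<in> H"
    and Y: "h \<in> H" "Y = oct_conj h X" and Lie: "Lie {X, Y} = g2"
  shows "H = G2"
proof
  have "oct_conj (mat 1) X \<in> Ad_span X" "oct_conj h X \<in> Ad_span X"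
    unfolding Ad_span_def using one_mem Y(1) by (intro span_base imageI; simp)+
  then have "{X, Y} \<subseteq> Ad_span X"
    by (simp add: oct_conj_def transpose_mat Y(2))
  then have "g2 \<subseteq> Ad_span X"
    unfolding Lie[symmetric] Lie_def by (rule hull_minimal) (rule lie_subalgebra_Ad_span[OF X exp])
  from contains_ball[OF exp this] contains_connected
  interpret G2_subgroup_connected H
    by unfold_locales blast
  show "G2 \<subseteq> H"
    by (rule G2_subset)
qed (rule subset_G2)

section \<open>The switch and the concluding theorem\<close>

lemma matrix_inv_switch: "matrix_inv switch = switch"
  by (rule matrix_inv_unique[OF switch_involution switch_involution])

lemma switch_nth:
  "(switch *v x) $ 0 = x $ 0" "(switch *v x) $ 1 = x $ 1" "(switch *v x) $ 2 = x $ 4" "(switch *v x) $ 3 = x $ 5"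
  "(switch *v x) $ 4 = x $ 2" "(switch *v x) $ 5 = x $ 3" "(switch *v x) $ 6 = - x $ 6" "(switch *v x) $ 7 = - x $ 7"
proof -
  have "linear (\<lambda>x :: octonion. x $ 0 *\<^sub>R oct_e 0 + x $ 1 *\<^sub>R oct_e 1
    + x $ 2 *\<^sub>R oct_e 4 + x $ 3 *\<^sub>R oct_e 5 + x $ 4 *\<^sub>R oct_e 2 + x $ 5 *\<^sub>R oct_e 3
    - x $ 6 *\<^sub>R oct_e 6 - x $ 7 *\<^sub>R oct_e 7)"
    by (rule linearI) (simp_all add: algebra_simps)
  then show
    "(switch *v x) $ 0 = x $ 0" "(switch *v x) $ 1 = x $ 1" "(switch *v x) $ 2 = x $ 4" "(switch *v x) $ 3 = x $ 5"
    "(switch *v x) $ 4 = x $ 2" "(switch *v x) $ 5 = x $ 3" "(switch *v x) $ 6 = - x $ 6" "(switch *v x) $ 7 = - x $ 7"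
    by (simp_all add: switch_def matrix_works oct_e_nth)
qed

lemma switch_mem_G2: "switch \<in> G2"
proof (rule G2_I)
  show "switch *v (x \<odot> y) = (switch *v x) \<odot> (switch *v y)" for x y
    unfolding vec_eq_iff forall_8 by (simp only: switch_nth oct_mult_nth) simp
qed (rule switch_apply)

lemma switch_conj_X_rows: "switch ** row_mat X_rows ** switch = row_mat Y_rows"
proof -
  have "switch *v (row_mat X_rows *v (switch *v x)) = row_mat Y_rows *v x" for x
    unfolding vec_eq_iff forall_8 by (simp only: switch_nth row_mat_X_rows_nth row_mat_Y_rows_nth) simp
  then show ?thesis
    by (simp add: matrix_eq flip: matrix_vector_mul_assoc)
qed

theorem theorem5p1:
  fixes X Y :: oct_end
  assumes X_def: "X = De 4 6 + De 4 7"
    and Y_def: "Y = switch ** X ** matrix_inv switch"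
  shows "Y = - (De 2 6 + De 2 7)
    \<and> Lie {X, Y} = g2
    \<and> dim (lie_filt X Y 0) = 2
    \<and> dim (lie_filt X Y 1) = 3
    \<and> dim (lie_filt X Y 2) = 5
    \<and> dim (lie_filt X Y 3) = 11
    \<and> dim (lie_filt X Y 4) = 14
    \<and> dim (lie_filt X Y 5) = 14
    \<and> (let gens = range (\<lambda>t::real. mat_exp (t *\<^sub>R X)) \<union> {switch}
       in \<forall>g\<in>G2. \<exists>ws. set ws \<subseteq> gens \<union> matrix_inv ` gens \<and> g = mat_prod ws)"
proof -
  have X_rows: "X = row_mat X_rows"
    by (simp only: X_def De_rows(1))
  have Y_rows: "Y = row_mat Y_rows"
    by (simp only: Y_def X_rows matrix_inv_switch switch_conj_X_rows)
  have X: "X = g2_basis 0" and Y: "Y = g2_basis 1"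
    by (simp_all add: X_rows Y_rows g2_basis_def g2_rows_def Let_def)
  have Lie: "Lie {X, Y} = g2"
    by (rule Lie_eq_g2[OF X Y])
  have X_g2: "X \<in> g2"
    by (simp add: X_rows rows_mem_g2)
  have dim_g2: "dim g2 = 14"
    using dim_span_g2_basis[of 14] by (simp add: span_g2_basis[OF X Y])
  define gens where "gens = range (\<lambda>t::real. mat_exp (t *\<^sub>R X)) \<union> {switch}"
  define S where "S = gens \<union> matrix_inv ` gens"
  have gens: "gens \<subseteq> G2"
    using mat_exp_mem_G2[OF X_g2] switch_mem_G2 by (auto simp: gens_def)
  \<comment> \<open>Inverses of generators are their transposes, which makes \<open>S\<close> closed
    under transposition.\<close>
  have S: "S = gens \<union> transpose ` gens"
    unfolding S_def using gens G2_transpose(3) by (intro arg_cong2[where f = "(\<union>)"] image_cong) auto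
  interpret G2_subgroup "{mat_prod ws | ws. set ws \<subseteq> S}"
    by (rule G2_subgroup_mat_prod) (use gens G2_transpose(4) in \<open>auto simp: S\<close>)
  have single: "g \<in> {mat_prod ws | ws. set ws \<subseteq> S}" if "g \<in> gens" for g
    using that by (auto simp: mat_prod_def S intro!: exI[of _ "[g]"])
  have "{mat_prod ws | ws. set ws \<subseteq> S} = G2"
  proof (rule eq_G2_if_Lie[OF X_g2 _ _ _ Lie])
    show "Y = oct_conj switch X"
      using G2_transpose(3)[OF switch_mem_G2] by (simp add: Y_def oct_conj_def)
    show "mat_exp (t *\<^sub>R X) \<in> {mat_prod ws | ws. set ws \<subseteq> S}" for t
      by (rule single) (simp add: gens_def)
    show "switch \<in> {mat_prod ws | ws. set ws \<subseteq> S}"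
      by (rule single) (simp add: gens_def)
  qed
  then have "\<forall>g\<in>G2. \<exists>ws. set ws \<subseteq> gens \<union> matrix_inv ` gens \<and> g = mat_prod ws"
    unfolding S_def by blast
  moreover have "dim (lie_filt X Y 0) = 2" "dim (lie_filt X Y 1) = 3" "dim (lie_filt X Y 2) = 5"
    "dim (lie_filt X Y 3) = 11"
    by (subst lie_filt_0[OF X Y] lie_filt_1[OF X Y] lie_filt_2[OF X Y] lie_filt_3[OF X Y],
        rule dim_span_g2_basis, simp)+
  moreover have "dim (lie_filt X Y 4) = 14" "dim (lie_filt X Y 5) = 14"
    by (simp_all only: lie_filt_4[OF X Y] lie_filt_5[OF X Y] dim_g2)
  moreover have "Y = - (De 2 6 + De 2 7)"
    by (simp only: Y_rows De_rows(2))
  ultimately show ?thesis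
    unfolding Let_def gens_def[symmetric] using Lie by (intro conjI)
qed

end
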